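(* Let $1<p<\infty$ and let $\Omega\subset\mathbb R^n$ be an open bounded domain. For any eigenfunction $u$ of the Dirichlet $p$-Laplacian eigenvalue problem on $\Omega$, with eigenvalue $\lambda$, and any $a>0$, there exists a positive constant $C>0$ such that the number of nodal domains $A\in\mathcal A(u)$ with $m_A\ge a$ does not exceed $C\,a^{-1}\lambda^{\frac np}$.
   Context: The $p$-Laplacian is $\Delta_pf=\operatorname{div}(|\nabla f|^{p-2}\nabla f)$. The Dirichlet eigenvalue problem is $\Delta_pu+\lambda|u|^{p-2}u=0$ in $\Omega$ with Dirichlet boundary conditions, in the weak sense: $\lambda$ is an eigenvalue with eigenfunction $u$ if $u\in W^{1,p}_0(\Omega)$ is non-trivial and $\int_\Omega|\nabla u|^{p-2}\nabla u\cdot\nabla v-\lambda\int_\Omega|u|^{p-2}uv=0$ for all $v\in C_0^\infty(\Omega)$. A nodal domain of $u$ is a maximal connected open subset of $\{u\ne0\}$; $\mathcal A(u)$ is the collection of all nodal domains of $u$, and $m_A=\max_{x\in A}|u(x)|$ for $A\in\mathcal A(u)$. *)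

theory Defs
  imports "HOL-Analysis.Analysis"
begin

primrec C_k :: "nat \<Rightarrow> ('a::euclidean_space \<Rightarrow> real) \<Rightarrow> bool" where
  "C_k 0 f \<longleftrightarrow> continuous_on UNIV f"
| "C_k (Suc k) f \<longleftrightarrow> (\<forall>x. f differentiable (at x)) \<and>
     (\<forall>i\<in>Basis. C_k k (\<lambda>x. frechet_derivative f (at x) i))"

definition test_functions :: "'a::euclidean_space set \<Rightarrow> ('a \<Rightarrow> real) set" where
  "test_functions \<Omega> = {v. (\<forall>k. C_k k v) \<and>
     compact (closure {x. v x \<noteq> 0}) \<and> closure {x. v x \<noteq> 0} \<subseteq> \<Omega>}"

definition grad :: "('a::euclidean_space \<Rightarrow> real) \<Rightarrow> 'a \<Rightarrow> 'a" where
  "grad v x = (\<Sum>i\<in>Basis. frechet_derivative v (at x) i *\<^sub>R i)"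

definition Lp_on :: "real \<Rightarrow> 'a::euclidean_space set \<Rightarrow> ('a \<Rightarrow> 'b::euclidean_space) \<Rightarrow> bool" where
  "Lp_on p \<Omega> f \<longleftrightarrow> f \<in> borel_measurable (lebesgue_on \<Omega>) \<and>
     integrable (lebesgue_on \<Omega>) (\<lambda>x. norm (f x) powr p)"

definition weak_gradient_on ::
    "'a::euclidean_space set \<Rightarrow> ('a \<Rightarrow> real) \<Rightarrow> ('a \<Rightarrow> 'a) \<Rightarrow> bool" where
  "weak_gradient_on \<Omega> u G \<longleftrightarrow> (\<forall>v\<in>test_functions \<Omega>. \<forall>i\<in>Basis.
     integral\<^sup>L (lebesgue_on \<Omega>) (\<lambda>x. u x * (grad v x \<bullet> i)) =
     - integral\<^sup>L (lebesgue_on \<Omega>) (\<lambda>x. (G x \<bullet> i) * v x))"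

text \<open>The pair of a function in the Sobolev space and its weak gradient, the latter
  being determined only up to null sets.\<close>

definition W1p :: "real \<Rightarrow> 'a::euclidean_space set \<Rightarrow> ('a \<Rightarrow> real) \<Rightarrow> ('a \<Rightarrow> 'a) \<Rightarrow> bool" where
  "W1p p \<Omega> u G \<longleftrightarrow> Lp_on p \<Omega> u \<and> Lp_on p \<Omega> G \<and> weak_gradient_on \<Omega> u G"

text \<open>Closure of the test functions in the Sobolev norm.\<close>

definition W1p_0 :: "real \<Rightarrow> 'a::euclidean_space set \<Rightarrow> ('a \<Rightarrow> real) \<Rightarrow> ('a \<Rightarrow> 'a) \<Rightarrow> bool" where
  "W1p_0 p \<Omega> u G \<longleftrightarrow> W1p p \<Omega> u G \<and>
     (\<exists>v :: nat \<Rightarrow> 'a \<Rightarrow> real. (\<forall>k. v k \<in> test_functions \<Omega>) \<and>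
       (\<lambda>k. integral\<^sup>L (lebesgue_on \<Omega>) (\<lambda>x. \<bar>u x - v k x\<bar> powr p)) \<longlonglongrightarrow> 0 \<and>
       (\<lambda>k. integral\<^sup>L (lebesgue_on \<Omega>) (\<lambda>x. norm (G x - grad (v k) x) powr p)) \<longlonglongrightarrow> 0)"

text \<open>For \<open>p < 2\<close> the convention \<open>0 powr (p - 2) = 0\<close> gives
  \<open>\<bar>s\<bar> powr (p - 2) * s = 0\<close> at \<open>s = 0\<close>, which is the usual reading.\<close>

definition dirichlet_p_eigenfunction ::
    "real \<Rightarrow> 'a::euclidean_space set \<Rightarrow> real \<Rightarrow> ('a \<Rightarrow> real) \<Rightarrow> bool" where
  "dirichlet_p_eigenfunction p \<Omega> lam u \<longleftrightarrow>
     \<not> (AE x in lebesgue_on \<Omega>. u x = 0) \<and>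
     (\<exists>G. W1p_0 p \<Omega> u G \<and>
       (\<forall>v\<in>test_functions \<Omega>.
          integral\<^sup>L (lebesgue_on \<Omega>) (\<lambda>x. (norm (G x) powr (p - 2) *\<^sub>R G x) \<bullet> grad v x)
          - lam * integral\<^sup>L (lebesgue_on \<Omega>) (\<lambda>x. \<bar>u x\<bar> powr (p - 2) * u x * v x) = 0))"

definition nodal_domains :: "'a::euclidean_space set \<Rightarrow> ('a \<Rightarrow> real) \<Rightarrow> 'a set set" where
  "nodal_domains \<Omega> u = {A. A \<noteq> {} \<and> open A \<and> connected A \<and> A \<subseteq> {x\<in>\<Omega>. u x \<noteq> 0} \<and>
     (\<forall>B. open B \<and> connected B \<and> B \<subseteq> {x\<in>\<Omega>. u x \<noteq> 0} \<and> A \<subseteq> B \<longrightarrow> B = A)}"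

text \<open>The maximum of \<open>\<bar>u\<bar>\<close> over \<open>A\<close>, written as an extended real supremum so that it is
  meaningful without knowing beforehand that the maximum is attained, or even finite.\<close>

definition nodal_max :: "('a \<Rightarrow> real) \<Rightarrow> 'a set \<Rightarrow> ereal" where
  "nodal_max u A = (SUP x\<in>A. ereal \<bar>u x\<bar>)"

end

(* Constants may depend on u, so it suffices that u is bounded and has finitely many nodal
   domains.  Both follow from one inequality.  Averaging the translation estimate
   |v(x+h) - v(x)|_p <= C |h| |grad v|_p over a ball of h with volume 2|S| yields, for v
   supported in S, the Poincare inequality |v|_p <= C |S|^(1/n) |grad v|_p; testing the
   equation with functions of u turns its right-hand side into an integral of u alone.
   Truncations (u - k)^+ give the De Giorgi recursion, hence boundedness.  The restriction of
   u to a nodal domain A gives |u|_p <= C |A|^(1/n) |u|_p on A, hence a lower bound for |A|. *)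
theory Submission
  imports Defs
begin

section \<open>Functions of class \<open>C_k\<close>\<close>

text \<open>Two obstacles shape the proof. The equation may be tested only with smooth functions of
  compact support in \<Omega>, while the natural tests are the positive part of u - k and u cut off
  to a nodal domain. Moreover u is continuous inside \<Omega> only, so nothing is known near the
  boundary, which a nodal domain may touch. Both are met by working with pairs (w, W) in the L^p
  closure of the pairs (v, grad v), and by replacing sharp truncations by smooth ones whose gradient
  is h G with 0 \<le> h \<le> L for a fixed L. The sign of h lets the tested equation control the
  energy of the test, and the bound L survives the limit. Boundedness comes first also because the
  construction on a nodal domain multiplies gradients known only in L^p by a function of u. The
  exponent p is kept throughout: the small factor |S|^(p/n) takes the place of a Sobolev embedding,
  and it leads to the recursion exponent 1 + p / (n (p - 1)).\<close>

lemma C_k_SucI: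
  assumes "\<And>x. (f has_derivative f' x) (at x)" "\<And>i. i \<in> Basis \<Longrightarrow> C_k k (\<lambda>x. f' x i)"
  shows "C_k (Suc k) f"
proof -
  have "f differentiable (at x)" "frechet_derivative f (at x) = f' x" for x
    using assms(1)[of x] frechet_derivative_at[OF assms(1)[of x]] by (auto simp: differentiable_def)
  then show ?thesis using assms(2) by simp
qed

lemma C_k_Suc_has_derivative:
  "C_k (Suc k) f \<Longrightarrow> (f has_derivative frechet_derivative f (at x)) (at x)"
  by (simp add: frechet_derivative_works[symmetric])

lemma C_k_SucD: "C_k (Suc k) f \<Longrightarrow> C_k k f"
proof (induction k arbitrary: f)
  case 0
  then show ?case
    by (auto intro!: continuous_at_imp_continuous_on differentiable_imp_continuous_within)
next
  case (Suc k)
  then show ?case by (simp only: C_k.simps(2)) blast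
qed

lemma C_k_const: "C_k k (\<lambda>x. c)"
proof (induction k arbitrary: c)
  case (Suc k)
  show ?case by (rule C_k_SucI[where f' = "\<lambda>x h. 0"]) (auto intro!: derivative_eq_intros Suc)
qed auto

lemma C_k_add:
  assumes "C_k k f" "C_k k g"
  shows "C_k k (\<lambda>x. f x + g x)"
  using assms
proof (induction k arbitrary: f g)
  case (Suc k)
  note d = C_k_Suc_has_derivative[OF Suc.prems(1)] C_k_Suc_has_derivative[OF Suc.prems(2)]
  show ?case
    by (rule C_k_SucI[OF has_derivative_add[OF d]]) (use Suc in auto)
qed (auto intro!: continuous_intros)

lemma C_k_mult:
  assumes "C_k k f" "C_k k g"
  shows "C_k k (\<lambda>x. f x * g x)"
  using assms
proof (induction k arbitrary: f g)
  case (Suc k)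
  note d = C_k_Suc_has_derivative[OF Suc.prems(1)] C_k_Suc_has_derivative[OF Suc.prems(2)]
  show ?case
    by (rule C_k_SucI[OF has_derivative_mult[OF d]])
      (use Suc C_k_SucD[OF Suc.prems(1)] C_k_SucD[OF Suc.prems(2)] in \<open>auto intro!: C_k_add\<close>)
qed (auto intro!: continuous_intros)

lemma C_k_diff:
  assumes "C_k k f" "C_k k g"
  shows "C_k k (\<lambda>x. f x - g x)"
  using C_k_add[OF assms(1) C_k_mult[OF C_k_const[of k "-1"] assms(2)]] by simp

lemma C_k_sum:
  assumes "\<And>i. i \<in> I \<Longrightarrow> C_k k (f i)"
  shows "C_k k (\<lambda>x. \<Sum>i\<in>I. f i x)"
  using assms by (induction I rule: infinite_finite_induct) (auto intro!: C_k_const C_k_add)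

lemma C_k_inner_left: "C_k k (\<lambda>x. x \<bullet> c)"
proof (cases k)
  case (Suc j)
  have "C_k (Suc j) (\<lambda>x. x \<bullet> c)"
    by (rule C_k_SucI[where f' = "\<lambda>x h. h \<bullet> c"]) (auto intro!: derivative_eq_intros C_k_const)
  then show ?thesis by (simp only: Suc)
qed (auto intro!: continuous_intros)

lemma C_k_inner_self: "C_k k (\<lambda>x. x \<bullet> x)"
proof -
  have "(\<lambda>x::'a. x \<bullet> x) = (\<lambda>x. \<Sum>i\<in>Basis. (x \<bullet> i) * (x \<bullet> i))"
    by (rule ext) (rule euclidean_inner)
  then show ?thesis by (auto intro!: C_k_sum C_k_mult C_k_inner_left)
qed

lemma C_k_compose:
  fixes g :: "real \<Rightarrow> real"
  assumes "C_k k g" "C_k k f"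
  shows "C_k k (\<lambda>x. g (f x))"
  using assms
proof (induction k arbitrary: f g)
  case 0
  then show ?case by (auto intro: continuous_on_compose2)
next
  case (Suc k)
  note g = C_k_Suc_has_derivative[OF Suc.prems(1)]
  note f = C_k_Suc_has_derivative[OF Suc.prems(2)]
  \<comment> \<open>A linear map on the reals is multiplication by its value at 1. This turns the
    chain rule into a product of two functions of class \<open>C_k k\<close>.\<close>
  have eq: "frechet_derivative g (at y) s = s * frechet_derivative g (at y) 1" for y s
    using linear_scale[OF has_derivative_linear[OF g], of y s 1] by simp
  show ?case
  proof (rule C_k_SucI[OF has_derivative_compose[OF f g]])
    fix i :: 'a assume i: "i \<in> Basis"
    have "C_k k (\<lambda>x. frechet_derivative g (at (f x)) 1)"
      using Suc.IH[of "\<lambda>y. frechet_derivative g (at y) 1" f] Suc.prems(1) C_k_SucD[OF Suc.prems(2)]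
      by simp
    then have "C_k k (\<lambda>x. frechet_derivative f (at x) i * frechet_derivative g (at (f x)) 1)"
      using i Suc.prems(2) by (intro C_k_mult) auto
    then show "C_k k (\<lambda>x. frechet_derivative g (at (f x)) (frechet_derivative f (at x) i))"
      by (subst eq)
  qed
qed

lemma C_k_SucI_real:
  fixes f :: "real \<Rightarrow> real"
  assumes "\<And>x. (f has_real_derivative f' x) (at x)" "C_k k f'"
  shows "C_k (Suc k) f"
  by (rule C_k_SucI[OF assms(1)[unfolded has_field_derivative_def]]) (use assms(2) in auto)

lemma C_k_imp_continuous: "C_k k f \<Longrightarrow> continuous_on S f"
  by (induction k) (auto intro: continuous_on_subset dest: C_k_SucD simp del: C_k.simps(2))

text \<open>For m = 0 this is the classical smooth function exp(-1/t), flat at the origin. The extra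
  power of 1/t makes the family closed under differentiation up to linear combinations, so that
  smoothness is a single induction. Every truncation, bump and cutoff below is built from
  it.\<close>

definition flat :: "nat \<Rightarrow> real \<Rightarrow> real" where
  "flat m t = (if t \<le> 0 then 0 else exp (- inverse t) * inverse t ^ m)"

text \<open>A single term of the exponential series is at most its sum.\<close>

lemma exp_minus_mult_power_le:
  assumes "(y::real) \<ge> 0" 
  shows "exp (- y) * y ^ m \<le> fact m"
proof -
  have "y ^ m / fact m \<le> exp y"
    using sum_le_suminf[OF summable_exp_generic[of y], of "{m}"] assms
    by (simp add: exp_def divide_inverse mult.commute)
  then show ?thesis
    by (simp add: exp_minus field_simps)
qed

lemma flat_nonneg: "0 \<le> flat m t"
  by (simp add: flat_def)

lemma flat_le: "flat m t \<le> fact m"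
  using exp_minus_mult_power_le[of "inverse t" m] by (simp add: flat_def)

lemma flat_Suc: "t * flat (Suc m) t = flat m t"
  by (simp add: flat_def)

lemma flat_nonpos: "t \<le> 0 \<Longrightarrow> flat m t = 0"
  by (simp add: flat_def)

lemma has_real_derivative_flat:
  "(flat m has_real_derivative flat (Suc (Suc m)) t - real m * flat (Suc m) t) (at t)"
proof (cases "t = 0")
  case True
  \<comment> \<open>The difference quotient at the origin equals
    \<open>h * flat (Suc (Suc m)) h\<close>, whose second factor is bounded.\<close>
  have "((\<lambda>h. flat m h / h) \<longlongrightarrow> 0) (at 0)"
  proof (rule tendsto_rabs_zero_cancel, rule tendsto_sandwich)
    show "\<forall>\<^sub>F h in at 0. \<bar>flat m h / h\<bar> \<le> \<bar>h\<bar> * fact (Suc (Suc m))"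
    proof (rule eventually_mono[OF eventually_neq_at_within[of 0]])
      fix h :: real assume "h \<noteq> 0"
      then have "flat m h / h = h * flat (Suc (Suc m)) h"
        using flat_Suc[of h m] flat_Suc[of h "Suc m"] by (simp add: field_simps)
      then show "\<bar>flat m h / h\<bar> \<le> \<bar>h\<bar> * fact (Suc (Suc m))"
        using flat_le[of "Suc (Suc m)" h] flat_nonneg[of "Suc (Suc m)" h]
        by (auto simp: abs_mult intro!: mult_left_mono)
    qed
  qed (auto intro!: tendsto_eq_intros)
  then show ?thesis using True by (simp add: has_field_derivative_iff flat_nonpos)
next
  case False
  show ?thesis
  proof (cases "t < 0")
    case True
    have "(flat m has_real_derivative 0) (at t)"
      by (rule has_field_derivative_transform_within_open[of "\<lambda>_. 0" _ _ "{..<0}"])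
        (use True in \<open>auto simp: flat_nonpos\<close>)
    then show ?thesis using True by (simp add: flat_nonpos)
  next
    case F: False
    with False have t: "t > 0" by simp
    have "((\<lambda>t. exp (- inverse t) * inverse t ^ m) has_real_derivative
      exp (- inverse t) * inverse t ^ Suc (Suc m) - m * (exp (- inverse t) * inverse t ^ Suc m)) (at t)"
      using t by (auto intro!: derivative_eq_intros simp: algebra_simps power2_eq_square)
        (cases m; simp add: algebra_simps power2_eq_square)
    then have "((\<lambda>t. exp (- inverse t) * inverse t ^ m) has_real_derivative
       flat (Suc (Suc m)) t - m * flat (Suc m) t) (at t)"
      using t by (simp add: flat_def)
    then show ?thesis
      by (rule has_field_derivative_transform_within_open[of _ _ _ "{0<..}"])
        (use t in \<open>auto simp: flat_def\<close>)
  qed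
qed

lemma C_k_flat: "C_k k (flat m)"
proof (induction k arbitrary: m)
  case 0
  then show ?case
    using has_real_derivative_flat[of m] by (auto intro!: continuous_at_imp_continuous_on DERIV_isCont)
next
  case (Suc k)
  show ?case
    by (rule C_k_SucI_real[OF has_real_derivative_flat])
      (auto intro!: C_k_diff C_k_mult C_k_const Suc)
qed

section \<open>A Poincare inequality with the measure of the support\<close>

text \<open>Young's inequality without optimal constants: one of the two terms alone suffices,
  according to whether b \<le> d x or not. The free parameter \<open>d\<close> is what later allows
  terms to be absorbed.\<close>

lemma powr_minus_one_mult_le:
  fixes x b d p :: real
  assumes "x \<ge> 0" "b \<ge> 0" "d > 0" "p > 1"
  shows "x powr (p - 1) * b \<le> d * x powr p + d powr (1 - p) * b powr p"
proof (cases "b \<le> d * x")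
  case True
  have "x powr (p - 1) * b \<le> x powr (p - 1) * (d * x)"
    using True by (intro mult_left_mono) auto
  also have "\<dots> = d * x powr p"
    using assms powr_mult_base[of x "p - 1"] by (cases "x = 0") (auto simp: mult_ac)
  finally show ?thesis using assms by (smt (verit) powr_ge_zero mult_nonneg_nonneg)
next
  case False
  then have b: "b > 0" using assms by (smt (verit) mult_nonneg_nonneg)
  have "x powr (p - 1) * b \<le> (b / d) powr (p - 1) * b"
    using False assms by (intro mult_right_mono powr_mono2) (auto simp: field_simps)
  also have "\<dots> = d powr (1 - p) * b powr p"
    using b assms by (simp add: powr_divide powr_diff field_simps)
  finally show ?thesis using assms by (smt (verit) powr_ge_zero mult_nonneg_nonneg)
qed

text \<open>Comparing with the maximum of the two norms avoids convexity. This matters because the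
  exponent p - 1, possibly below 1, occurs too.\<close>

lemma norm_add_powr_le:
  fixes a b :: "'a::real_normed_vector"
  assumes "p \<ge> 0"
  shows "norm (a + b) powr p \<le> 2 powr p * (norm a powr p + norm b powr p)"
proof -
  have "norm (a + b) powr p \<le> (2 * max (norm a) (norm b)) powr p"
    using assms norm_triangle_ineq[of a b] by (intro powr_mono2) auto
  also have "\<dots> = 2 powr p * max (norm a) (norm b) powr p"
    by (simp add: powr_mult)
  also have "\<dots> \<le> 2 powr p * (norm a powr p + norm b powr p)"
    by (intro mult_left_mono) (auto simp: max_def)
  finally show ?thesis .
qed

section \<open>Gradients of smooth functions\<close>

lemma frechet_derivative_eq_grad:
  assumes "v differentiable (at x)"
  shows "frechet_derivative v (at x) h = grad v x \<bullet> h"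
proof -
  have lin: "linear (frechet_derivative v (at x))"
    using assms by (simp add: linear_frechet_derivative)
  have "frechet_derivative v (at x) h = frechet_derivative v (at x) (\<Sum>i\<in>Basis. (h \<bullet> i) *\<^sub>R i)"
    by (simp add: euclidean_representation)
  also have "\<dots> = (\<Sum>i\<in>Basis. (h \<bullet> i) * frechet_derivative v (at x) i)"
    by (simp add: linear_sum[OF lin] linear_scale[OF lin])
  also have "\<dots> = grad v x \<bullet> h"
    by (simp add: grad_def inner_sum_left inner_commute[of h] mult.commute)
  finally show ?thesis .
qed

lemma has_derivative_grad:
  assumes "C_k (Suc k) v"
  shows "(v has_derivative (\<lambda>h. grad v x \<bullet> h)) (at x)"
proof -
  have "v differentiable (at x)" using assms by simp
  then show ?thesis
    using C_k_Suc_has_derivative[OF assms, of x] frechet_derivative_eq_grad[of v x] by (metis ext)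
qed

lemma grad_eqI:
  assumes "(v has_derivative (\<lambda>h. g \<bullet> h)) (at x)"
  shows "grad v x = g"
  unfolding grad_def frechet_derivative_at[OF assms, symmetric]
  by (metis (no_types) euclidean_representation)

lemma continuous_on_grad: "C_k (Suc k) v \<Longrightarrow> continuous_on S (grad v)"
  unfolding grad_def by (auto intro!: continuous_intros C_k_imp_continuous)

text \<open>A substitute for Jensen's inequality: multiply c \<le> \<integral>f by c^(p-1), apply
  Young's inequality with d = 1/2 under the integral, and absorb c^p / 2 on the left.\<close>

lemma integral_powr_le:
  fixes f :: "real \<Rightarrow> real"
  assumes "continuous_on UNIV f" "\<And>s. 0 \<le> f s" "0 \<le> c" "c \<le> integral {0..1} f" "p > 1"
  shows "ennreal (c powr p) \<le> ennreal (2 powr p) * (\<integral>\<^sup>+s\<in>{0..1}. ennreal (f s powr p) \<partial>lborel)"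
proof -
  have cont: "continuous_on {0..1} f"
    using assms(1) continuous_on_subset by blast
  then have contp: "continuous_on {0..1} (\<lambda>s. f s powr p)"
    using assms by (intro continuous_on_powr') auto
  have int: "(\<lambda>s. f s powr p) integrable_on {0..1}" "f integrable_on {0..1}"
    using cont contp integrable_continuous_real by blast+
  have "c powr p = c powr (p - 1) * c"
    using powr_mult_base[of c "p - 1"] assms(3) by (cases "c = 0") (auto simp: mult.commute)
  also have "\<dots> \<le> c powr (p - 1) * integral {0..1} f"
    using assms by (intro mult_left_mono) auto
  also have "\<dots> = integral {0..1} (\<lambda>s. c powr (p - 1) * f s)"
    by simp
  also have "\<dots> \<le> integral {0..1} (\<lambda>s. (1/2) * c powr p + (1/2) powr (1 - p) * f s powr p)"
    using assms
    by (intro integral_le integrable_continuous_real continuous_intros cont contp powr_minus_one_mult_le) auto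
  also have "\<dots> = c powr p / 2 + (1/2) powr (1 - p) * integral {0..1} (\<lambda>s. f s powr p)"
    by (subst Henstock_Kurzweil_Integration.integral_add)
      (auto intro!: integrable_continuous_real continuous_intros contp)
  also have "(1/2::real) powr (1 - p) = 2 powr p / 2"
    by (simp add: powr_divide powr_diff)
  finally have main: "c powr p \<le> 2 powr p * integral {0..1} (\<lambda>s. f s powr p)"
    by simp
  have [measurable]: "f \<in> borel_measurable borel"
    using assms(1) by (rule borel_measurable_continuous_onI)
  have "(\<integral>\<^sup>+s\<in>{0..1}. ennreal (f s powr p) \<partial>lborel) = ennreal (integral {0..1} (\<lambda>s. f s powr p))"
    by (rule nn_integral_has_integral_lebesgue') (auto intro: integrable_integral[OF int(1)])
  then show ?thesis
    using main integral_nonneg[OF int(1)] by (simp add: ennreal_mult'[symmetric])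
qed

lemma nn_integral_lborel_shift:
  fixes f :: "'a::euclidean_space \<Rightarrow> ennreal"
  assumes [measurable]: "f \<in> borel_measurable borel"
  shows "(\<integral>\<^sup>+x. f (x + c) \<partial>lborel) = (\<integral>\<^sup>+x. f x \<partial>lborel)"
  by (subst (2) lborel_distr_plus[of c, symmetric]) (simp add: nn_integral_distr add.commute)

text \<open>Along the segment from x to x + h the increment of v is the integral of grad v . h, and
  \<open>integral_powr_le\<close> moves the p-th power inside. After Fubini every point of the
  segment contributes the same integral, by translation invariance. Extended nonnegative integrals
  remove all questions of integrability.\<close>

lemma nn_integral_translation_le:
  fixes v :: "'a::euclidean_space \<Rightarrow> real"
  assumes v: "C_k (Suc 0) v" and p: "p > 1"
  shows "(\<integral>\<^sup>+x. ennreal (\<bar>v (x + h) - v x\<bar> powr p) \<partial>lborel)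
    \<le> ennreal (2 powr p * norm h powr p) * (\<integral>\<^sup>+x. ennreal (norm (grad v x) powr p) \<partial>lborel)"
proof -
  have cg: "continuous_on S (grad v)" for S by (rule continuous_on_grad[OF v])
  have [measurable]: "grad v \<in> borel_measurable borel"
    using cg by (rule borel_measurable_continuous_onI)
  have pt: "ennreal (\<bar>v (x + h) - v x\<bar> powr p) \<le>
     ennreal (2 powr p * norm h powr p) * (\<integral>\<^sup>+s\<in>{0..1}. ennreal (norm (grad v (x + s *\<^sub>R h)) powr p) \<partial>lborel)" for x
  proof -
    let ?f = "\<lambda>s::real. norm (grad v (x + s *\<^sub>R h)) * norm h"
    have cf: "continuous_on S ?f" for S
      by (intro continuous_intros continuous_on_compose2[OF cg[of UNIV]]) auto
    have "((\<lambda>s. grad v (x + s *\<^sub>R h) \<bullet> h) has_integral (v (x + 1 *\<^sub>R h) - v (x + 0 *\<^sub>R h))) {0..1}"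
    proof (rule fundamental_theorem_of_calculus)
      fix s :: real
      have "((\<lambda>s. v (x + s *\<^sub>R h)) has_derivative (\<lambda>t. grad v (x + s *\<^sub>R h) \<bullet> (t *\<^sub>R h))) (at s within {0..1})"
        by (rule has_derivative_compose[OF _ has_derivative_grad[OF v]])
          (auto intro!: derivative_eq_intros)
      then show "((\<lambda>s. v (x + s *\<^sub>R h)) has_vector_derivative grad v (x + s *\<^sub>R h) \<bullet> h) (at s within {0..1})"
        by (simp add: has_vector_derivative_def)
    qed auto
    then have i: "((\<lambda>s. grad v (x + s *\<^sub>R h) \<bullet> h) has_integral (v (x + h) - v x)) {0..1}"
      by simp
    have "\<bar>v (x + h) - v x\<bar> \<le> integral {0..1} ?f"
      using integral_norm_bound_integral[OF has_integral_integrable[OF i]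
          integrable_continuous_real[OF cf], of] integral_unique[OF i]
      by (simp add: Cauchy_Schwarz_ineq2)
    then have "ennreal (\<bar>v (x + h) - v x\<bar> powr p)
        \<le> ennreal (2 powr p) * (\<integral>\<^sup>+s\<in>{0..1}. ennreal (?f s powr p) \<partial>lborel)"
      using cf p by (intro integral_powr_le) auto
    also have "(\<integral>\<^sup>+s\<in>{0..1}. ennreal (?f s powr p) \<partial>lborel)
       = ennreal (norm h powr p) * (\<integral>\<^sup>+s\<in>{0..1}. ennreal (norm (grad v (x + s *\<^sub>R h)) powr p) \<partial>lborel)"
      by (subst nn_integral_cmult[symmetric])
        (auto intro!: nn_integral_cong simp: powr_mult ennreal_mult' mult_ac)
    finally show ?thesis by (simp add: ennreal_mult' mult.assoc)
  qed
  have "(\<integral>\<^sup>+x. ennreal (\<bar>v (x + h) - v x\<bar> powr p) \<partial>lborel) \<le>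
     (\<integral>\<^sup>+x. ennreal (2 powr p * norm h powr p) * (\<integral>\<^sup>+s\<in>{0..1}. ennreal (norm (grad v (x + s *\<^sub>R h)) powr p) \<partial>lborel) \<partial>lborel)"
    by (intro nn_integral_mono pt)
  also have "\<dots> = ennreal (2 powr p * norm h powr p) * (\<integral>\<^sup>+x. (\<integral>\<^sup>+s\<in>{0..1}. ennreal (norm (grad v (x + s *\<^sub>R h)) powr p) \<partial>lborel) \<partial>lborel)"
    by (subst nn_integral_cmult) auto
  also have "(\<integral>\<^sup>+x. (\<integral>\<^sup>+s\<in>{0..1::real}. ennreal (norm (grad v (x + s *\<^sub>R h)) powr p) \<partial>lborel) \<partial>lborel)
    = (\<integral>\<^sup>+s. (\<integral>\<^sup>+x. ennreal (norm (grad v (x + s *\<^sub>R h)) powr p) * indicator {0..1::real} s \<partial>lborel) \<partial>lborel)"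
    by (subst lborel_pair.Fubini') auto
  also have "\<dots> = (\<integral>\<^sup>+s. (\<integral>\<^sup>+x. ennreal (norm (grad v x) powr p) \<partial>lborel) * indicator {0..1::real} s \<partial>lborel)"
    by (intro nn_integral_cong, subst nn_integral_multc, simp)
      (simp add: nn_integral_lborel_shift[of "\<lambda>x. ennreal (norm (grad v x) powr p)"])
  also have "\<dots> = (\<integral>\<^sup>+x. ennreal (norm (grad v x) powr p) \<partial>lborel)"
    by (subst nn_integral_cmult) auto
  finally show ?thesis .
qed

text \<open>Here v need not vanish outside S: the estimate will be applied to test functions that
  merely approximate a function vanishing there, and the integral over \<open>-S\<close> measures
  the failure.\<close>

lemma nn_integral_poincare:
  fixes v :: "'a::euclidean_space \<Rightarrow> real"
  assumes v: "C_k (Suc 0) v" and p: "p > 1" and S: "S \<in> sets borel" and r: "r > 0"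
    and meas: "2 * emeasure lborel S \<le> emeasure lborel (ball 0 r :: 'a set)"
  shows "(\<integral>\<^sup>+x\<in>S. ennreal (\<bar>v x\<bar> powr p) \<partial>lborel)
    \<le> ennreal (2 * 4 powr p) * (ennreal (r powr p) * (\<integral>\<^sup>+x. ennreal (norm (grad v x) powr p) \<partial>lborel)
        + (\<integral>\<^sup>+x\<in>-S. ennreal (\<bar>v x\<bar> powr p) \<partial>lborel))"
proof -
  define B where "B = (ball 0 r :: 'a set)"
  have [measurable]: "B \<in> sets borel" unfolding B_def by simp
  let ?f = "\<lambda>x. ennreal (\<bar>v x\<bar> powr p)"
  let ?V = "emeasure lborel B"
  let ?D = "\<integral>\<^sup>+x. ennreal (norm (grad v x) powr p) \<partial>lborel"
    have [measurable]: "v \<in> borel_measurable borel"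
    using v by (intro borel_measurable_continuous_onI C_k_imp_continuous)
  note [measurable] = S
  define T where "T = - S"
  have [measurable]: "T \<in> sets borel" using S unfolding T_def by (rule borel_comp)
  let ?Q = "\<integral>\<^sup>+x\<in>T. ?f x \<partial>lborel"
  have V: "?V \<noteq> \<infinity>" "?V \<noteq> 0"
    using content_ball_gt_0_iff[of "0::'a" r] r emeasure_lborel_ball_finite[of "0::'a" r]
    by (auto simp: measure_def B_def)
  \<comment> \<open>At least half of all translations move a given point out of \<open>S\<close>.\<close>
  have half: "?V \<le> 2 * (\<integral>\<^sup>+h. indicator B h * indicator T (x + h) \<partial>lborel)" (is "_ \<le> 2 * ?b") for x
  proof -
    have "?V = (\<integral>\<^sup>+h. indicator B h \<partial>lborel)" by simp
    also have "\<dots> \<le> (\<integral>\<^sup>+h. indicator S (h + x) + indicator B h * indicator T (x + h) \<partial>lborel)"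
      by (intro nn_integral_mono) (auto simp: indicator_def add.commute T_def)
    also have "\<dots> = (\<integral>\<^sup>+h. indicator S (h + x) \<partial>lborel) + ?b"
      by (subst nn_integral_add) auto
    also have "(\<integral>\<^sup>+h. indicator S (h + x) \<partial>lborel) = emeasure lborel S"
      using nn_integral_lborel_shift[of "indicator S" x] by simp
    finally have "2 * ?V \<le> 2 * emeasure lborel S + 2 * ?b"
      by (metis distrib_left mult_left_mono zero_le)
    also have "\<dots> \<le> ?V + 2 * ?b" using meas by (intro add_right_mono) (simp add: B_def)
    finally have "?V + ?V \<le> ?V + 2 * ?b" by (simp add: mult_2)
    then show ?thesis using V(1) by (simp add: ennreal_add_left_cancel_le)
  qed
  have pt: "?f x \<le> ennreal (2 powr p) * (ennreal (\<bar>v (x + h) - v x\<bar> powr p) + ?f (x + h))" for x h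
    using norm_add_powr_le[of p "v x - v (x + h)" "v (x + h)"] p
    by (simp add: ennreal_mult'[symmetric] ennreal_plus[symmetric] abs_minus_commute del: ennreal_plus)
  \<comment> \<open>Integrate \<open>half\<close> against |v|^p over S and exchange the integrals.
    For fixed h only those x in S remain for which x + h lies outside S, and for them
    \<open>pt\<close> bounds v x by the increment and by the value at x + h.\<close>
  have "?V * (\<integral>\<^sup>+x\<in>S. ?f x \<partial>lborel) = (\<integral>\<^sup>+x\<in>S. ?V * ?f x \<partial>lborel)"
    by (subst nn_integral_cmult[symmetric]) (auto intro!: nn_integral_cong simp: mult.assoc)
  also have "\<dots> \<le> (\<integral>\<^sup>+x\<in>S. 2 * (\<integral>\<^sup>+h. indicator B h * indicator T (x + h) \<partial>lborel) * ?f x \<partial>lborel)"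
    by (intro nn_integral_mono mult_right_mono half) auto
  also have "\<dots> = 2 * (\<integral>\<^sup>+x. (\<integral>\<^sup>+h. indicator B h * indicator T (x + h) * ?f x * indicator S x \<partial>lborel) \<partial>lborel)"
    by (subst nn_integral_cmult[symmetric])
      (auto intro!: nn_integral_cong simp: mult.assoc nn_integral_multc[symmetric])
  also have "(\<integral>\<^sup>+x. (\<integral>\<^sup>+h. indicator B h * indicator T (x + h) * ?f x * indicator S x \<partial>lborel) \<partial>lborel)
     = (\<integral>\<^sup>+h. (\<integral>\<^sup>+x. indicator B h * indicator T (x + h) * ?f x * indicator S x \<partial>lborel) \<partial>lborel)"
    by (subst lborel_pair.Fubini') auto
  also have "\<dots> \<le> (\<integral>\<^sup>+h. ennreal (2 powr p) * (ennreal (2 powr p * r powr p) * ?D + ?Q) * indicator B h \<partial>lborel)"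
  proof (intro nn_integral_mono)
    fix h :: 'a
    show "(\<integral>\<^sup>+x. indicator B h * indicator T (x + h) * ?f x * indicator S x \<partial>lborel)
      \<le> ennreal (2 powr p) * (ennreal (2 powr p * r powr p) * ?D + ?Q) * indicator B h"
    proof (cases "h \<in> B")
      case True
      have "(\<integral>\<^sup>+x. indicator B h * indicator T (x + h) * ?f x * indicator S x \<partial>lborel)
        \<le> (\<integral>\<^sup>+x. ennreal (2 powr p) * (ennreal (\<bar>v (x + h) - v x\<bar> powr p) + ?f (x + h) * indicator T (x + h)) \<partial>lborel)"
        using pt by (intro nn_integral_mono) (auto simp: indicator_def)
      also have "\<dots> = ennreal (2 powr p) * ((\<integral>\<^sup>+x. ennreal (\<bar>v (x + h) - v x\<bar> powr p) \<partial>lborel)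
          + (\<integral>\<^sup>+x. ?f (x + h) * indicator T (x + h) \<partial>lborel))"
        by (subst nn_integral_cmult, simp, subst nn_integral_add) auto
      also have "(\<integral>\<^sup>+x. ?f (x + h) * indicator T (x + h) \<partial>lborel) = ?Q"
        by (rule nn_integral_lborel_shift[of "\<lambda>x. ?f x * indicator T x"]) auto
      also have "(\<integral>\<^sup>+x. ennreal (\<bar>v (x + h) - v x\<bar> powr p) \<partial>lborel)
          \<le> ennreal (2 powr p * norm h powr p) * ?D"
        by (rule nn_integral_translation_le[OF v p])
      also have "\<dots> \<le> ennreal (2 powr p * r powr p) * ?D"
        using True p unfolding B_def by (intro mult_right_mono ennreal_leI mult_left_mono powr_mono2) auto
      finally show ?thesis using True
        by (simp add: add_right_mono mult_left_mono)
    qed auto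
  qed
  also have "\<dots> = ?V * (ennreal (2 powr p) * (ennreal (2 powr p * r powr p) * ?D + ?Q))"
    by (subst nn_integral_cmult) (auto simp: mult.commute)
  finally have "?V * (\<integral>\<^sup>+x\<in>S. ?f x \<partial>lborel) \<le> ?V * (2 * (ennreal (2 powr p) * (ennreal (2 powr p * r powr p) * ?D + ?Q)))"
    by (simp add: mult.left_commute[of _ 2] mult_left_mono)
  then have "(\<integral>\<^sup>+x\<in>S. ?f x \<partial>lborel) \<le> 2 * (ennreal (2 powr p) * (ennreal (2 powr p * r powr p) * ?D + ?Q))"
    using V by (subst (asm) ennreal_mult_le_mult_iff) auto
  \<comment> \<open>The second term is enlarged by \<open>2 powr p\<close> merely to give both terms
    the same constant.\<close>
  also have "\<dots> \<le> 2 * (ennreal (2 powr p) * (ennreal (2 powr p) * (ennreal (r powr p) * ?D) + ennreal (2 powr p) * ?Q))"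
  proof -
    have "1 \<le> ennreal (2 powr p)" using p by (simp add: ge_one_powr_ge_zero)
    then have "?Q \<le> ennreal (2 powr p) * ?Q" using mult_right_mono[of 1 "ennreal (2 powr p)" ?Q] by simp
    then show ?thesis
      by (intro mult_left_mono add_mono) (auto simp: ennreal_mult' mult.assoc)
  qed
  also have "\<dots> = ennreal (2 * (2 powr p * 2 powr p)) * (ennreal (r powr p) * ?D + ?Q)"
    by (simp add: ennreal_mult' distrib_left mult.assoc)
  also have "2 * (2 powr p * 2 powr p) = 2 * 4 powr p"
    by (simp add: powr_mult[symmetric])
  finally show ?thesis by (simp add: T_def)
qed

section \<open>The closure of the test functions\<close>

lemma test_functions_C_k: "v \<in> test_functions \<Omega> \<Longrightarrow> C_k k v"
  by (simp add: test_functions_def)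

lemma test_functions_eq_0: "v \<in> test_functions \<Omega> \<Longrightarrow> x \<notin> \<Omega> \<Longrightarrow> v x = 0"
  using closure_subset[of "{x. v x \<noteq> 0}"] by (auto simp: test_functions_def)

lemma grad_eq_0_outside_support:
  assumes "x \<notin> closure {x. v x \<noteq> 0}"
  shows "grad v x = 0"
proof (rule grad_eqI)
  have "((\<lambda>x. 0) has_derivative (\<lambda>h. 0)) (at x)" by simp
  then show "(v has_derivative (\<lambda>h. 0 \<bullet> h)) (at x)"
    unfolding inner_zero_left
  proof (rule has_derivative_transform_within_open[where s = "- closure {x. v x \<noteq> 0}"])
    fix y assume "y \<in> - closure {x. v x \<noteq> 0}"
    then show "0 = v y" using closure_subset[of "{x. v x \<noteq> 0}"] by auto
  qed (use assms in \<open>auto simp: open_closed\<close>)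
qed

lemma test_functions_grad_eq_0: "v \<in> test_functions \<Omega> \<Longrightarrow> x \<notin> \<Omega> \<Longrightarrow> grad v x = 0"
  by (rule grad_eq_0_outside_support) (auto simp: test_functions_def)

lemma bounded_if_compact_support:
  fixes f :: "'a::topological_space \<Rightarrow> 'b::real_normed_vector"
  assumes "continuous_on UNIV f" "compact K" "\<And>x. x \<notin> K \<Longrightarrow> f x = 0"
  obtains L where "L > 0" "\<And>x. norm (f x) \<le> L"
proof -
  have "bounded (f ` K)"
    using assms by (intro compact_imp_bounded compact_continuous_image)
      (auto intro: continuous_on_subset)
  then obtain L where L: "L > 0" "\<And>x. x \<in> K \<Longrightarrow> norm (f x) \<le> L"
    by (auto simp: bounded_pos)
  then show thesis using assms(3) by (intro that[of L]) (metis norm_zero order.strict_implies_order)+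
qed

lemma grad_mult:
  assumes "C_k (Suc 0) f" "C_k (Suc 0) g"
  shows "grad (\<lambda>x. f x * g x) x = f x *\<^sub>R grad g x + g x *\<^sub>R grad f x"
  by (rule grad_eqI)
    (auto intro!: derivative_eq_intros has_derivative_grad assms simp: inner_add_left)

lemma grad_compose:
  fixes g :: "real \<Rightarrow> real"
  assumes "C_k (Suc 0) f" "(g has_real_derivative g') (at (f x))"
  shows "grad (\<lambda>x. g (f x)) x = g' *\<^sub>R grad f x"
proof (rule grad_eqI)
  show "((\<lambda>x. g (f x)) has_derivative (\<lambda>h. (g' *\<^sub>R grad f x) \<bullet> h)) (at x)"
    using has_derivative_compose[OF has_derivative_grad[OF assms(1)]
        assms(2)[unfolded has_field_derivative_def]]
    by simp
qed

lemma test_functions_multiplier: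
  assumes "v \<in> test_functions \<Omega>" "\<And>k. C_k k b" "\<And>x. v x = 0 \<Longrightarrow> b x = 0"
  shows "b \<in> test_functions \<Omega>"
proof -
  have "closure {x. b x \<noteq> 0} \<subseteq> closure {x. v x \<noteq> 0}"
    using assms(3) by (intro closure_mono) auto
  moreover from this have "compact (closure {x. b x \<noteq> 0})"
    using assms(1) closed_Int_compact[OF closed_closure, of "closure {x. v x \<noteq> 0}" "{x. b x \<noteq> 0}"]
    by (simp add: test_functions_def Int_absorb2)
  ultimately show ?thesis using assms by (auto simp: test_functions_def)
qed

section \<open>L^p functions on a bounded open set\<close>

locale bounded_domain =
  fixes \<Omega> :: "'a::euclidean_space set" and p :: real
  assumes p: "1 < p" and open_domain: "open \<Omega>" and bounded_domain: "bounded \<Omega>"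
begin

lemma domain_sets [measurable, simp]: "\<Omega> \<in> sets lebesgue"
  using open_domain by (simp add: borel_open)

lemma finite_measure_domain: "finite_measure (lebesgue_on \<Omega>)"
  using open_domain bounded_domain lmeasurable_open finite_measure_lebesgue_on by blast

lemma borel_measurable_lebesgue_on:
  "f \<in> borel_measurable borel \<Longrightarrow> f \<in> borel_measurable (lebesgue_on \<Omega>)"
  by (intro measurable_restrict_space1 measurable_completion) simp

lemma continuous_borel_measurable:
  "continuous_on UNIV f \<Longrightarrow> f \<in> borel_measurable (lebesgue_on \<Omega>)"
  by (intro borel_measurable_lebesgue_on borel_measurable_continuous_onI)

text \<open>The p-th power of the L^p norm. Leaving out the root costs a factor
  \<open>2 powr p\<close> in the triangle inequality, which is harmless for limits.\<close>

definition Lint :: "('a \<Rightarrow> 'b::euclidean_space) \<Rightarrow> real" where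
  "Lint f = integral\<^sup>L (lebesgue_on \<Omega>) (\<lambda>x. norm (f x) powr p)"

lemma Lint_nonneg: "0 \<le> Lint f"
  unfolding Lint_def by (rule integral_nonneg_AE) simp

lemma Lp_on_measurable: "Lp_on p \<Omega> f \<Longrightarrow> f \<in> borel_measurable (lebesgue_on \<Omega>)"
  by (simp add: Lp_on_def)

lemma Lp_on_integrable: "Lp_on p \<Omega> f \<Longrightarrow> integrable (lebesgue_on \<Omega>) (\<lambda>x. norm (f x) powr p)"
  by (simp add: Lp_on_def)

lemma Lp_on_dominated:
  assumes f: "f \<in> borel_measurable (lebesgue_on \<Omega>)"
    and g: "integrable (lebesgue_on \<Omega>) g"
    and le: "AE x in lebesgue_on \<Omega>. norm (f x) powr p \<le> g x"
  shows "Lp_on p \<Omega> f"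
  unfolding Lp_on_def
proof (intro conjI f Bochner_Integration.integrable_bound[OF g])
  show "(\<lambda>x. norm (f x) powr p) \<in> borel_measurable (lebesgue_on \<Omega>)" using f by measurable
  show "AE x in lebesgue_on \<Omega>. norm (norm (f x) powr p) \<le> norm (g x)"
    using le by eventually_elim auto
qed

lemma Lp_on_bounded:
  assumes "f \<in> borel_measurable (lebesgue_on \<Omega>)" "\<And>x. x \<in> \<Omega> \<Longrightarrow> norm (f x) \<le> L"
  shows "Lp_on p \<Omega> f"
proof (rule Lp_on_dominated[OF assms(1)])
  show "integrable (lebesgue_on \<Omega>) (\<lambda>x. L powr p)"
    using finite_measure_domain by (simp add: finite_measure.integrable_const)
  show "AE x in lebesgue_on \<Omega>. norm (f x) powr p \<le> L powr p"
    using assms(2) p by (auto intro!: AE_I2 powr_mono2)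
qed

lemma Lp_on_add:
  assumes "Lp_on p \<Omega> f" "Lp_on p \<Omega> g"
  shows "Lp_on p \<Omega> (\<lambda>x. f x + g x)"
proof (rule Lp_on_dominated)
  show "integrable (lebesgue_on \<Omega>) (\<lambda>x. 2 powr p * (norm (f x) powr p + norm (g x) powr p))"
    using assms by (auto simp: Lp_on_def)
  show "(\<lambda>x. f x + g x) \<in> borel_measurable (lebesgue_on \<Omega>)"
    using assms by (auto simp: Lp_on_def)
qed (use norm_add_powr_le[of p] p in \<open>auto intro!: AE_I2\<close>)

lemma Lp_on_mult_bounded:
  assumes "b \<in> borel_measurable (lebesgue_on \<Omega>)" "\<And>x. x \<in> \<Omega> \<Longrightarrow> \<bar>b x\<bar> \<le> L" "Lp_on p \<Omega> f"
  shows "Lp_on p \<Omega> (\<lambda>x. b x *\<^sub>R f x)"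
proof (rule Lp_on_dominated)
  show "integrable (lebesgue_on \<Omega>) (\<lambda>x. L powr p * norm (f x) powr p)"
    using assms by (auto simp: Lp_on_def)
  show "(\<lambda>x. b x *\<^sub>R f x) \<in> borel_measurable (lebesgue_on \<Omega>)"
    using assms by (auto simp: Lp_on_def)
  show "AE x in lebesgue_on \<Omega>. norm (b x *\<^sub>R f x) powr p \<le> L powr p * norm (f x) powr p"
    using assms(2) p by (auto intro!: AE_I2 mult_right_mono powr_mono2 simp: powr_mult)
qed

lemma Lp_on_uminus: "Lp_on p \<Omega> f \<Longrightarrow> Lp_on p \<Omega> (\<lambda>x. - f x)"
  by (simp add: Lp_on_def)

lemma Lp_on_diff: "Lp_on p \<Omega> f \<Longrightarrow> Lp_on p \<Omega> g \<Longrightarrow> Lp_on p \<Omega> (\<lambda>x. f x - g x)"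
  using Lp_on_add[of f "\<lambda>x. - g x"] Lp_on_uminus[of g] by simp

lemma Lp_on_cong: "(\<And>x. x \<in> \<Omega> \<Longrightarrow> f x = g x) \<Longrightarrow> Lp_on p \<Omega> f \<longleftrightarrow> Lp_on p \<Omega> g"
  unfolding Lp_on_def
  by (intro arg_cong2[of _ _ _ _ "(\<and>)"] measurable_cong Bochner_Integration.integrable_cong) auto

lemma Lint_cong: "(\<And>x. x \<in> \<Omega> \<Longrightarrow> norm (f x) = norm (g x)) \<Longrightarrow> Lint f = Lint g"
  unfolding Lint_def by (intro Bochner_Integration.integral_cong) auto

lemma Lint_mono:
  assumes "Lp_on p \<Omega> g" "\<And>x. x \<in> \<Omega> \<Longrightarrow> norm (f x) \<le> norm (g x)"
  shows "Lint f \<le> Lint g"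
  unfolding Lint_def
  using assms p by (intro integral_mono_AE') (auto simp: Lp_on_def intro!: AE_I2 powr_mono2)

lemma Lint_add_le:
  assumes "Lp_on p \<Omega> f" "Lp_on p \<Omega> g"
  shows "Lint (\<lambda>x. f x + g x) \<le> 2 powr p * (Lint f + Lint g)"
proof -
  have "Lint (\<lambda>x. f x + g x) \<le> integral\<^sup>L (lebesgue_on \<Omega>) (\<lambda>x. 2 powr p * (norm (f x) powr p + norm (g x) powr p))"
    unfolding Lint_def using assms p Lp_on_add[OF assms] norm_add_powr_le[of p]
    by (intro integral_mono) (auto simp: Lp_on_def)
  also have "\<dots> = 2 powr p * (Lint f + Lint g)"
    using assms by (simp add: Lint_def Lp_on_def)
  finally show ?thesis .
qed

lemma Lint_scaleR: "Lint (\<lambda>x. c *\<^sub>R f x) = \<bar>c\<bar> powr p * Lint f"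
  by (simp add: Lint_def powr_mult)

lemma Lint_mult_bounded_le:
  assumes "\<And>x. x \<in> \<Omega> \<Longrightarrow> \<bar>b x\<bar> \<le> L" "L \<ge> 0" "Lp_on p \<Omega> f"
  shows "Lint (\<lambda>x. b x *\<^sub>R f x) \<le> L powr p * Lint f"
proof -
  have "Lint (\<lambda>x. b x *\<^sub>R f x) \<le> Lint (\<lambda>x. L *\<^sub>R f x)"
    using assms Lp_on_mult_bounded[of "\<lambda>_. L" L f]
    by (intro Lint_mono) (auto intro!: mult_right_mono)
  then show ?thesis using assms by (simp add: Lint_scaleR)
qed

lemma Lint_diff_commute: "Lint (\<lambda>x. f x - g x) = Lint (\<lambda>x. g x - f x)"
  by (simp add: Lint_def norm_minus_commute)

text \<open>Dominated convergence with a multiple of |f|^p. It serves factors such as \<theta>'(v k)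
  - \<theta>'(w), which are bounded and tend to 0 almost everywhere but come with no rate.\<close>

lemma Lint_mult_tendsto_0:
  assumes b: "\<And>k. b k \<in> borel_measurable (lebesgue_on \<Omega>)" "\<And>k x. x \<in> \<Omega> \<Longrightarrow> \<bar>b k x\<bar> \<le> L"
    and lim: "AE x in lebesgue_on \<Omega>. (\<lambda>k. b k x) \<longlonglongrightarrow> 0"
    and f: "Lp_on p \<Omega> f"
  shows "(\<lambda>k. Lint (\<lambda>x. b k x *\<^sub>R f x)) \<longlonglongrightarrow> 0"
proof -
  have "(\<lambda>k. Lint (\<lambda>x. b k x *\<^sub>R f x)) \<longlonglongrightarrow> integral\<^sup>L (lebesgue_on \<Omega>) (\<lambda>x. 0)"
    unfolding Lint_def
  proof (rule integral_dominated_convergence)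
    show "integrable (lebesgue_on \<Omega>) (\<lambda>x. L powr p * norm (f x) powr p)"
      using f by (auto simp: Lp_on_def)
    show "(\<lambda>x. norm (b k x *\<^sub>R f x) powr p) \<in> borel_measurable (lebesgue_on \<Omega>)" for k
      using b Lp_on_measurable[OF f] by measurable
    show "AE x in lebesgue_on \<Omega>. norm (norm (b k x *\<^sub>R f x) powr p) \<le> L powr p * norm (f x) powr p" for k
      using b(2) p by (auto intro!: AE_I2 mult_right_mono powr_mono2 simp: powr_mult)
    show "AE x in lebesgue_on \<Omega>. (\<lambda>k. norm (b k x *\<^sub>R f x) powr p) \<longlonglongrightarrow> 0"
      using lim
    proof eventually_elim
      case (elim x)
      then have "(\<lambda>k. norm (b k x *\<^sub>R f x)) \<longlonglongrightarrow> 0"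
        by (auto intro!: tendsto_eq_intros tendsto_norm_zero)
      then have "(\<lambda>k. norm (b k x *\<^sub>R f x) powr p) \<longlonglongrightarrow> 0 powr p"
        using p by (intro tendsto_powr') auto
      then show ?case by simp
    qed
  qed simp
  then show ?thesis by simp
qed

lemma Lint_tendsto_AE_subseq:
  assumes "\<And>k. Lp_on p \<Omega> (f k)" "(\<lambda>k. Lint (f k)) \<longlonglongrightarrow> 0"
  obtains r where "strict_mono r" "AE x in lebesgue_on \<Omega>. (\<lambda>k. f (r k) x) \<longlonglongrightarrow> 0"
proof -
  obtain r where r: "strict_mono r" "AE x in lebesgue_on \<Omega>. (\<lambda>k. norm (f (r k) x) powr p) \<longlonglongrightarrow> 0"
    using tendsto_L1_AE_subseq[of "lebesgue_on \<Omega>" "\<lambda>k x. norm (f k x) powr p"] assms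
    by (auto simp: Lint_def Lp_on_def)
  have "AE x in lebesgue_on \<Omega>. (\<lambda>k. f (r k) x) \<longlonglongrightarrow> 0"
    using r(2)
  proof eventually_elim
    case (elim x)
    have "(\<lambda>k. (norm (f (r k) x) powr p) powr (1 / p)) \<longlonglongrightarrow> 0 powr (1 / p)"
      using p by (intro tendsto_powr' elim) auto
    then show ?case using p by (simp add: powr_powr tendsto_norm_zero_iff)
  qed
  with r(1) show thesis by (rule that)
qed

lemma test_function_Lp:
  assumes v: "v \<in> test_functions \<Omega>"
  shows "Lp_on p \<Omega> v" "Lp_on p \<Omega> (grad v)"
proof -
  have K: "compact (closure {x. v x \<noteq> 0})" using v by (simp add: test_functions_def)
  have c: "continuous_on UNIV v" "continuous_on UNIV (grad v)"
    using test_functions_C_k[OF v] by (auto intro: C_k_imp_continuous continuous_on_grad)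
  have "v x = 0" if "x \<notin> closure {x. v x \<noteq> 0}" for x
    using that closure_subset[of "{x. v x \<noteq> 0}"] by auto
  then obtain L where "\<And>x. norm (v x) \<le> L"
    using bounded_if_compact_support[OF c(1) K] by blast
  then show "Lp_on p \<Omega> v"
    by (intro Lp_on_bounded[of _ L] continuous_borel_measurable c) auto
  obtain L where "\<And>x. norm (grad v x) \<le> L"
    using bounded_if_compact_support[OF c(2) K] grad_eq_0_outside_support by blast
  then show "Lp_on p \<Omega> (grad v)"
    by (intro Lp_on_bounded[of _ L] continuous_borel_measurable c) auto
qed

text \<open>The L^p closure of the graph of the gradient on test functions. The gradient
  \<open>W\<close> is part of the data, so that calculus rules are proved by passing to the limit in
  both components at once.\<close>

definition sobolev_0 :: "('a \<Rightarrow> real) \<Rightarrow> ('a \<Rightarrow> 'a) \<Rightarrow> bool" where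
  "sobolev_0 w W \<longleftrightarrow> Lp_on p \<Omega> w \<and> Lp_on p \<Omega> W \<and>
     (\<forall>e>0. \<exists>v\<in>test_functions \<Omega>. Lint (\<lambda>x. w x - v x) < e \<and> Lint (\<lambda>x. W x - grad v x) < e)"

lemma sobolev_0_Lp: "sobolev_0 w W \<Longrightarrow> Lp_on p \<Omega> w" "sobolev_0 w W \<Longrightarrow> Lp_on p \<Omega> W"
  by (simp_all add: sobolev_0_def)

lemma sobolev_0_cong:
  assumes "\<And>x. x \<in> \<Omega> \<Longrightarrow> w x = w' x" "\<And>x. x \<in> \<Omega> \<Longrightarrow> W x = W' x"
  shows "sobolev_0 w W \<longleftrightarrow> sobolev_0 w' W'"
proof -
  have "Lint (\<lambda>x. w x - v x) = Lint (\<lambda>x. w' x - v x)"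
    "Lint (\<lambda>x. W x - grad v x) = Lint (\<lambda>x. W' x - grad v x)" for v
    using assms by (auto intro!: Lint_cong)
  moreover have "Lp_on p \<Omega> w \<longleftrightarrow> Lp_on p \<Omega> w'" "Lp_on p \<Omega> W \<longleftrightarrow> Lp_on p \<Omega> W'"
    using assms by (auto intro!: Lp_on_cong)
  ultimately show ?thesis by (simp add: sobolev_0_def)
qed

lemma sobolev_0_limit:
  assumes "\<And>k. sobolev_0 (w k) (W k)" "Lp_on p \<Omega> w'" "Lp_on p \<Omega> W'"
    and "(\<lambda>k. Lint (\<lambda>x. w k x - w' x)) \<longlonglongrightarrow> 0" "(\<lambda>k. Lint (\<lambda>x. W k x - W' x)) \<longlonglongrightarrow> 0"
  shows "sobolev_0 w' W'"
  unfolding sobolev_0_def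
proof (intro conjI allI impI assms(2,3))
  fix e :: real assume e: "e > 0"
  define d where "d = e / (2 powr p * 2)"
  have d: "d > 0" "2 powr p * (d + d) = e" using e by (auto simp: d_def)
  have "\<forall>\<^sub>F k in sequentially. Lint (\<lambda>x. w k x - w' x) < d \<and> Lint (\<lambda>x. W k x - W' x) < d"
    using order_tendstoD(2)[OF assms(4) d(1)] order_tendstoD(2)[OF assms(5) d(1)]
    by (rule eventually_conj)
  then obtain k where k: "Lint (\<lambda>x. w k x - w' x) < d" "Lint (\<lambda>x. W k x - W' x) < d"
    by (auto simp: eventually_sequentially)
  obtain v where v: "v \<in> test_functions \<Omega>" "Lint (\<lambda>x. w k x - v x) < d" "Lint (\<lambda>x. W k x - grad v x) < d"
    using assms(1)[of k] d by (auto simp: sobolev_0_def)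
  note Lp = assms(2,3) sobolev_0_Lp[OF assms(1)[of k]] test_function_Lp[OF v(1)]
  have "Lint (\<lambda>x. w' x - v x) < e"
    using Lint_add_le[OF Lp_on_diff[OF Lp(1,3)] Lp_on_diff[OF Lp(3,5)]] k v
    by (subst d(2)[symmetric]) (auto simp: Lint_diff_commute[of w'] intro: le_less_trans)
  moreover have "Lint (\<lambda>x. W' x - grad v x) < e"
    using Lint_add_le[OF Lp_on_diff[OF Lp(2,4)] Lp_on_diff[OF Lp(4,6)]] k v
    by (subst d(2)[symmetric]) (auto simp: Lint_diff_commute[of W'] intro: le_less_trans)
  ultimately show "\<exists>v\<in>test_functions \<Omega>. Lint (\<lambda>x. w' x - v x) < e \<and> Lint (\<lambda>x. W' x - grad v x) < e"
    using v(1) by blast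
qed

text \<open>Convergence almost everywhere, gained by passing to a subsequence, is the extra
  information that dominated convergence needs.\<close>

lemma sobolev_0_sequence:
  assumes "sobolev_0 w W"
  obtains v where "\<And>k. v k \<in> test_functions \<Omega>"
    "AE x in lebesgue_on \<Omega>. (\<lambda>k. v k x) \<longlonglongrightarrow> w x"
    "(\<lambda>k. Lint (\<lambda>x. v k x - w x)) \<longlonglongrightarrow> 0" "(\<lambda>k. Lint (\<lambda>x. grad (v k) x - W x)) \<longlonglongrightarrow> 0"
proof -
  have "\<exists>v\<in>test_functions \<Omega>. Lint (\<lambda>x. v x - w x) < inverse (real (Suc k)) \<and> Lint (\<lambda>x. grad v x - W x) < inverse (real (Suc k))" for k
    using assms by (simp add: sobolev_0_def Lint_diff_commute[of w] Lint_diff_commute[of W])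
  then obtain v where v: "\<And>k. v k \<in> test_functions \<Omega>"
    "\<And>k. Lint (\<lambda>x. v k x - w x) < inverse (real (Suc k))" "\<And>k. Lint (\<lambda>x. grad (v k) x - W x) < inverse (real (Suc k))"
    by metis
  have z: "(\<lambda>k. inverse (real (Suc k))) \<longlonglongrightarrow> 0" by (rule LIMSEQ_inverse_real_of_nat)
  have l1: "(\<lambda>k. Lint (\<lambda>x. v k x - w x)) \<longlonglongrightarrow> 0"
    by (rule tendsto_sandwich[OF _ _ tendsto_const z]) (simp_all add: Lint_nonneg less_imp_le[OF v(2)] less_imp_le[OF v(3)] del: of_nat_Suc)
  have l2: "(\<lambda>k. Lint (\<lambda>x. grad (v k) x - W x)) \<longlonglongrightarrow> 0"
    by (rule tendsto_sandwich[OF _ _ tendsto_const z]) (simp_all add: Lint_nonneg less_imp_le[OF v(2)] less_imp_le[OF v(3)] del: of_nat_Suc)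
  have "Lp_on p \<Omega> (\<lambda>x. v k x - w x)" for k
    by (intro Lp_on_diff test_function_Lp v sobolev_0_Lp[OF assms])
  then obtain r where r: "strict_mono r" "AE x in lebesgue_on \<Omega>. (\<lambda>k. v (r k) x - w x) \<longlonglongrightarrow> 0"
    using Lint_tendsto_AE_subseq[OF _ l1] by blast
  show thesis
  proof (rule that[of "\<lambda>k. v (r k)"])
    show "AE x in lebesgue_on \<Omega>. (\<lambda>k. v (r k) x) \<longlonglongrightarrow> w x"
      using r(2) by eventually_elim (simp add: LIM_zero_iff)
  qed (use v(1) LIMSEQ_subseq_LIMSEQ[OF l1 r(1)] LIMSEQ_subseq_LIMSEQ[OF l2 r(1)] in \<open>auto simp: o_def\<close>)
qed

end

lemma C_k_real_derivative_continuous: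
  fixes \<theta> :: "real \<Rightarrow> real"
  assumes "C_k (Suc 0) \<theta>" "\<And>t. (\<theta> has_real_derivative \<theta>' t) (at t)"
  shows "continuous_on S \<theta>'"
proof -
  have "frechet_derivative \<theta> (at t) 1 = \<theta>' t" for t
    using frechet_derivative_at[OF assms(2)[of t, unfolded has_field_derivative_def]]
    by (metis mult.right_neutral)
  then have "\<theta>' = (\<lambda>t. frechet_derivative \<theta> (at t) 1)" by auto
  then show ?thesis using assms(1) by (auto intro: continuous_on_subset)
qed

lemma le_if_le_add_mult_epsilon:
  fixes a b c :: real
  assumes "\<And>e. e > 0 \<Longrightarrow> a \<le> b + c * e" "c \<ge> 0"
  shows "a \<le> b"
proof (rule field_le_epsilon)
  fix e :: real assume e: "e > 0"
  then have "a \<le> b + c * (e / (c + 1))" using assms by (intro assms) simp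
  also have "c * (e / (c + 1)) \<le> e" using e assms by (simp add: field_simps)
  finally show "a \<le> b + e" by simp
qed

section \<open>Poincare inequality and weak pairing on the closure of the test functions\<close>

context bounded_domain
begin

lemma ennreal_Lint:
  assumes "Lp_on p \<Omega> f"
  shows "ennreal (Lint f) = (\<integral>\<^sup>+x\<in>\<Omega>. ennreal (norm (f x) powr p) \<partial>lborel)"
  unfolding Lint_def
  by (subst nn_integral_eq_integral[symmetric])
    (auto simp: nn_integral_restrict_space nn_integral_completion Lp_on_integrable[OF assms])

lemma Lp_on_indicator:
  assumes "S \<in> sets borel" "Lp_on p \<Omega> f"
  shows "Lp_on p \<Omega> (\<lambda>x. indicator S x *\<^sub>R f x)"
  using assms by (intro Lp_on_mult_bounded[of _ 1] borel_measurable_lebesgue_on) (auto simp: indicator_def)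

lemma Lint_indicator_le:
  assumes "Lp_on p \<Omega> f"
  shows "Lint (\<lambda>x. indicator S x *\<^sub>R f x) \<le> Lint f"
  using assms by (intro Lint_mono) (auto simp: indicator_def)

lemma test_function_poincare:
  assumes v: "v \<in> test_functions \<Omega>" and S: "S \<in> sets borel" "S \<subseteq> \<Omega>" and r: "r > 0"
    and meas: "2 * emeasure lborel S \<le> emeasure lborel (ball 0 r :: 'a set)"
  shows "Lint (\<lambda>x. indicator S x *\<^sub>R v x)
     \<le> 2 * 4 powr p * (r powr p * Lint (grad v) + Lint (\<lambda>x. indicator (-S) x *\<^sub>R v x))"
proof -
  note Lp = test_function_Lp[OF v]
  have S': "- S \<in> sets borel" using S(1) by (rule borel_comp)
  have 1: "(\<integral>\<^sup>+x\<in>S. ennreal (\<bar>v x\<bar> powr p) \<partial>lborel) = ennreal (Lint (\<lambda>x. indicator S x *\<^sub>R v x))"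
    using S p by (subst ennreal_Lint[OF Lp_on_indicator[OF S(1) Lp(1)]])
      (auto intro!: nn_integral_cong simp: indicator_def)
  have 2: "(\<integral>\<^sup>+x\<in>-S. ennreal (\<bar>v x\<bar> powr p) \<partial>lborel) = ennreal (Lint (\<lambda>x. indicator (-S) x *\<^sub>R v x))"
    using p test_functions_eq_0[OF v] by (subst ennreal_Lint[OF Lp_on_indicator[OF S' Lp(1)]])
      (auto intro!: nn_integral_cong simp: indicator_def)
  have 3: "(\<integral>\<^sup>+x. ennreal (norm (grad v x) powr p) \<partial>lborel) = ennreal (Lint (grad v))"
    using p test_functions_grad_eq_0[OF v] by (subst ennreal_Lint[OF Lp(2)])
      (auto intro!: nn_integral_cong simp: indicator_def)
  have "ennreal (Lint (\<lambda>x. indicator S x *\<^sub>R v x)) \<le> ennreal (2 * 4 powr p) *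
     (ennreal (r powr p) * ennreal (Lint (grad v)) + ennreal (Lint (\<lambda>x. indicator (-S) x *\<^sub>R v x)))"
    using nn_integral_poincare[OF test_functions_C_k[OF v] p S(1) r meas] unfolding 1 2 3 .
  also have "\<dots> = ennreal (2 * 4 powr p * (r powr p * Lint (grad v) + Lint (\<lambda>x. indicator (-S) x *\<^sub>R v x)))"
    by (simp add: ennreal_mult' Lint_nonneg)
  finally show ?thesis
    by (subst (asm) ennreal_le_iff) (auto intro!: mult_nonneg_nonneg add_nonneg_nonneg Lint_nonneg)
qed

text \<open>Approximate w by a test function v. Since w vanishes outside S, v agrees there with the
  approximation error up to sign, so the error term in the estimate for v disappears as e tends to
  0.\<close>

lemma sobolev_0_poincare:
  assumes w: "sobolev_0 w W" and S: "S \<in> sets borel" "S \<subseteq> \<Omega>" and r: "r > 0"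
    and meas: "2 * emeasure lborel S \<le> emeasure lborel (ball 0 r :: 'a set)"
    and vanish: "\<And>x. x \<in> \<Omega> \<Longrightarrow> x \<notin> S \<Longrightarrow> w x = 0"
  shows "Lint w \<le> 2 * 16 powr p * r powr p * Lint W"
proof -
  \<comment> \<open>Two triangle inequalities, one for the functions and one for the gradients, cost
    a factor q each on top of 2 * 4 powr p = 2 q^2; this is the origin of 2 * 16 powr p = 2
    q^4.\<close>
  define q where "q = (2::real) powr p"
  have q: "q > 0" "4 powr p = q * q" "16 powr p = q * q * q * q"
    by (simp_all add: q_def powr_mult[symmetric])
  have S': "- S \<in> sets borel" using S(1) by (rule borel_comp)
  show ?thesis
  proof (rule le_if_le_add_mult_epsilon)
    fix e :: real assume "e > 0"
    then obtain v where v: "v \<in> test_functions \<Omega>" "Lint (\<lambda>x. w x - v x) < e" "Lint (\<lambda>x. W x - grad v x) < e"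
      using w by (auto simp: sobolev_0_def)
    note Lp = sobolev_0_Lp[OF w] test_function_Lp[OF v(1)]
    have "Lint w = Lint (\<lambda>x. indicator S x *\<^sub>R v x + indicator S x *\<^sub>R (w x - v x))"
      using vanish by (intro Lint_cong) (auto simp: indicator_def)
    also have "\<dots> \<le> q * (Lint (\<lambda>x. indicator S x *\<^sub>R v x) + Lint (\<lambda>x. indicator S x *\<^sub>R (w x - v x)))"
      unfolding q_def by (intro Lint_add_le Lp_on_indicator S Lp Lp_on_diff)
    also have "Lint (\<lambda>x. indicator S x *\<^sub>R (w x - v x)) \<le> e"
      using Lint_indicator_le[OF Lp_on_diff[OF Lp(1,3)], of S] v by linarith
    also have "Lint (\<lambda>x. indicator S x *\<^sub>R v x)
       \<le> 2 * (q * q) * (r powr p * Lint (grad v) + Lint (\<lambda>x. indicator (-S) x *\<^sub>R v x))"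
      using test_function_poincare[OF v(1) S r meas] by (simp add: q)
    also have "Lint (\<lambda>x. indicator (-S) x *\<^sub>R v x) = Lint (\<lambda>x. indicator (-S) x *\<^sub>R (w x - v x))"
      using vanish by (intro Lint_cong) (auto simp: indicator_def)
    also have "\<dots> \<le> e"
      using Lint_indicator_le[OF Lp_on_diff[OF Lp(1,3)], of "-S"] v by linarith
    also have "Lint (grad v) = Lint (\<lambda>x. W x + (grad v x - W x))"
      by simp
    also have "\<dots> \<le> q * (Lint W + Lint (\<lambda>x. grad v x - W x))"
      unfolding q_def by (intro Lint_add_le Lp Lp_on_diff)
    also have "Lint (\<lambda>x. grad v x - W x) \<le> e"
      using v by (simp add: Lint_diff_commute[of "grad v"])
    finally have "Lint w \<le> q * (2 * (q * q) * (r powr p * (q * (Lint W + e)) + e) + e)"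
      using q(1) by (simp add: mult_left_mono)
    also have "\<dots> = 2 * 16 powr p * r powr p * Lint W + q * (2 * (q * q) * (r powr p * q + 1) + 1) * e"
      by (simp add: q algebra_simps)
    finally show "Lint w \<le> 2 * 16 powr p * r powr p * Lint W + q * (2 * (q * q) * (r powr p * q + 1) + 1) * e" .
  qed (use q(1) in simp)
qed

text \<open>A common form of both sides of the equation: vector-valued with \<open>G\<close> on the
  left, real-valued with \<open>u\<close> on the right.\<close>

definition pairing :: "('a \<Rightarrow> 'b::euclidean_space) \<Rightarrow> ('a \<Rightarrow> 'b) \<Rightarrow> real" where
  "pairing f g = integral\<^sup>L (lebesgue_on \<Omega>) (\<lambda>x. (norm (f x) powr (p - 2) *\<^sub>R f x) \<bullet> g x)"

lemma norm_powr_scaleR: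
  fixes a :: "'b::real_normed_vector"
  shows "norm (norm a powr (p - 2) *\<^sub>R a) = norm a powr (p - 1)"
proof (cases "a = 0")
  case False
  then have "norm a powr (p - 2) * norm a powr 1 = norm a powr (p - 1)"
    by (subst powr_add[symmetric]) simp
  then show ?thesis using False by simp
qed (use p in simp)

lemma pairing_pointwise:
  fixes a b :: "'b::euclidean_space"
  assumes "d > 0"
  shows "\<bar>(norm a powr (p - 2) *\<^sub>R a) \<bullet> b\<bar> \<le> d * norm a powr p + d powr (1 - p) * norm b powr p"
  using Cauchy_Schwarz_ineq2[of "norm a powr (p - 2) *\<^sub>R a" b] norm_powr_scaleR[of a]
    powr_minus_one_mult_le[of "norm a" "norm b" d p] assms p by simp

lemma pairing_integrable:
  assumes "Lp_on p \<Omega> f" "Lp_on p \<Omega> g"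
  shows "integrable (lebesgue_on \<Omega>) (\<lambda>x. (norm (f x) powr (p - 2) *\<^sub>R f x) \<bullet> g x)"
proof (rule Bochner_Integration.integrable_bound)
  show "integrable (lebesgue_on \<Omega>) (\<lambda>x. 1 * norm (f x) powr p + 1 powr (1 - p) * norm (g x) powr p)"
    using assms by (auto simp: Lp_on_def)
  show "(\<lambda>x. (norm (f x) powr (p - 2) *\<^sub>R f x) \<bullet> g x) \<in> borel_measurable (lebesgue_on \<Omega>)"
    using assms[THEN Lp_on_measurable] by measurable
  show "AE x in lebesgue_on \<Omega>. norm ((norm (f x) powr (p - 2) *\<^sub>R f x) \<bullet> g x)
      \<le> norm (1 * norm (f x) powr p + 1 powr (1 - p) * norm (g x) powr p)"
    using pairing_pointwise[of 1] by (intro AE_I2) (simp only: real_norm_def, fastforce)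
qed

text \<open>Replaces Hoelder's inequality. Continuity in \<open>g\<close> follows by choosing
  \<open>d\<close> small first and then \<open>Lint g\<close> small in terms of
  \<open>d\<close>.\<close>

lemma pairing_bound:
  assumes "Lp_on p \<Omega> f" "Lp_on p \<Omega> g" "d > 0"
  shows "\<bar>pairing f g\<bar> \<le> d * Lint f + d powr (1 - p) * Lint g"
proof -
  have "\<bar>pairing f g\<bar> \<le> integral\<^sup>L (lebesgue_on \<Omega>) (\<lambda>x. \<bar>(norm (f x) powr (p - 2) *\<^sub>R f x) \<bullet> g x\<bar>)"
    unfolding pairing_def by (rule integral_abs_bound)
  also have "\<dots> \<le> integral\<^sup>L (lebesgue_on \<Omega>) (\<lambda>x. d * norm (f x) powr p + d powr (1 - p) * norm (g x) powr p)"
    using assms pairing_pointwise[OF assms(3)]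
    by (intro integral_mono integrable_abs pairing_integrable) (auto simp: Lp_on_def)
  also have "\<dots> = d * Lint f + d powr (1 - p) * Lint g"
    using assms by (simp add: Lint_def Lp_on_def)
  finally show ?thesis .
qed

lemma pairing_diff:
  assumes "Lp_on p \<Omega> f" "Lp_on p \<Omega> g" "Lp_on p \<Omega> h"
  shows "pairing f (\<lambda>x. g x - h x) = pairing f g - pairing f h"
  using assms by (simp add: pairing_def inner_diff_right pairing_integrable del: inner_scaleR_left)

section \<open>Chain rule and product rule in the closure\<close>

lemma sobolev_0_test: "v \<in> test_functions \<Omega> \<Longrightarrow> sobolev_0 v (grad v)"
  using p by (auto simp: sobolev_0_def test_function_Lp Lint_def intro!: bexI[of _ v])

lemma Lint_tendsto_0I:
  assumes "\<And>k. Lint (f k) \<le> c k" "c \<longlonglongrightarrow> 0"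
  shows "(\<lambda>k. Lint (f k)) \<longlonglongrightarrow> 0"
  by (rule tendsto_sandwich[OF _ _ tendsto_const assms(2)]) (simp_all add: assms(1) Lint_nonneg)

lemma chain_tendsto:
  fixes \<theta> :: "real \<Rightarrow> real"
  assumes \<theta>: "C_k (Suc 0) \<theta>" "\<And>t. (\<theta> has_real_derivative \<theta>' t) (at t)" "\<And>t. \<bar>\<theta>' t\<bar> \<le> L"
    and w: "Lp_on p \<Omega> w" "Lp_on p \<Omega> W" and v: "\<And>k. v k \<in> test_functions \<Omega>"
    and lim: "AE x in lebesgue_on \<Omega>. (\<lambda>k. v k x) \<longlonglongrightarrow> w x"
    "(\<lambda>k. Lint (\<lambda>x. v k x - w x)) \<longlonglongrightarrow> 0" "(\<lambda>k. Lint (\<lambda>x. grad (v k) x - W x)) \<longlonglongrightarrow> 0"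
  shows "(\<lambda>k. Lint (\<lambda>x. \<theta> (v k x) - \<theta> (w x))) \<longlonglongrightarrow> 0"
    and "(\<lambda>k. Lint (\<lambda>x. \<theta>' (v k x) *\<^sub>R grad (v k) x - \<theta>' (w x) *\<^sub>R W x)) \<longlonglongrightarrow> 0"
proof -
  have L: "L \<ge> 0" using \<theta>(3)[of 0] by simp
  have c: "continuous_on UNIV \<theta>'"
    by (rule C_k_real_derivative_continuous[OF \<theta>(1,2)])
  then have m: "\<theta>' \<in> borel_measurable borel" by (rule borel_measurable_continuous_onI)
  note mv = Lp_on_measurable[OF test_function_Lp(1)[OF v]]
  note mw = Lp_on_measurable[OF w(1)]
  have lip: "\<bar>\<theta> s - \<theta> t\<bar> \<le> L * \<bar>s - t\<bar>" for s t
    using field_differentiable_bound[of UNIV \<theta> \<theta>' L s t] \<theta>(2,3) by simp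
  have d: "Lp_on p \<Omega> (\<lambda>x. v k x - w x)" "Lp_on p \<Omega> (\<lambda>x. grad (v k) x - W x)" for k
    by (intro Lp_on_diff w test_function_Lp v)+
  have mult: "Lp_on p \<Omega> (\<lambda>x. L *\<^sub>R (v k x - w x))" for k
    by (rule Lp_on_mult_bounded[OF _ _ d(1), of _ "\<bar>L\<bar>"]) auto
  show "(\<lambda>k. Lint (\<lambda>x. \<theta> (v k x) - \<theta> (w x))) \<longlonglongrightarrow> 0"
  proof (rule Lint_tendsto_0I)
    show "Lint (\<lambda>x. \<theta> (v k x) - \<theta> (w x)) \<le> \<bar>L\<bar> powr p * Lint (\<lambda>x. v k x - w x)" for k
      unfolding Lint_scaleR[symmetric] using lip L mult
      by (intro Lint_mono) (auto simp: abs_mult)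
    show "(\<lambda>k. \<bar>L\<bar> powr p * Lint (\<lambda>x. v k x - w x)) \<longlonglongrightarrow> 0"
      using tendsto_mult_left[OF lim(2)] by simp
  qed
  have meas: "(\<lambda>x. \<theta>' (v k x)) \<in> borel_measurable (lebesgue_on \<Omega>)"
    "(\<lambda>x. \<theta>' (w x)) \<in> borel_measurable (lebesgue_on \<Omega>)" for k
    using measurable_compose[OF mv m] measurable_compose[OF mw m] by auto
  have md: "(\<lambda>x. \<theta>' (v k x) - \<theta>' (w x)) \<in> borel_measurable (lebesgue_on \<Omega>)" for k
    using meas by (intro borel_measurable_diff) auto
  have bd: "\<bar>\<theta>' (v k x) - \<theta>' (w x)\<bar> \<le> 2 * L" for k x
    using \<theta>(3)[of "v k x"] \<theta>(3)[of "w x"] by linarith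
  have z: "(\<lambda>k. Lint (\<lambda>x. (\<theta>' (v k x) - \<theta>' (w x)) *\<^sub>R W x)) \<longlonglongrightarrow> 0"
  proof (rule Lint_mult_tendsto_0[OF md bd _ w(2)])
    show "AE x in lebesgue_on \<Omega>. (\<lambda>k. \<theta>' (v k x) - \<theta>' (w x)) \<longlonglongrightarrow> 0"
      using lim(1)
    proof eventually_elim
      case (elim x)
      then have "(\<lambda>k. \<theta>' (v k x)) \<longlonglongrightarrow> \<theta>' (w x)"
        by (rule continuous_on_tendsto_compose[OF c]) auto
      then show ?case by (simp add: LIM_zero)
    qed
  qed
  show "(\<lambda>k. Lint (\<lambda>x. \<theta>' (v k x) *\<^sub>R grad (v k) x - \<theta>' (w x) *\<^sub>R W x)) \<longlonglongrightarrow> 0"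
  proof (rule Lint_tendsto_0I)
    fix k
    \<comment> \<open>Add and subtract \<open>\<theta>' (v k x) *\<^sub>R W x\<close>: one part is
      controlled by the L^p convergence of the gradients, the other by \<open>z\<close>, that is, by
      convergence almost everywhere, since \<theta>' is not assumed Lipschitz.\<close>
    have "Lint (\<lambda>x. \<theta>' (v k x) *\<^sub>R grad (v k) x - \<theta>' (w x) *\<^sub>R W x)
      = Lint (\<lambda>x. \<theta>' (v k x) *\<^sub>R (grad (v k) x - W x) + (\<theta>' (v k x) - \<theta>' (w x)) *\<^sub>R W x)"
      by (simp add: algebra_simps)
    also have "\<dots> \<le> 2 powr p * (Lint (\<lambda>x. \<theta>' (v k x) *\<^sub>R (grad (v k) x - W x)) + Lint (\<lambda>x. (\<theta>' (v k x) - \<theta>' (w x)) *\<^sub>R W x))"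
      by (intro Lint_add_le Lp_on_mult_bounded[OF meas(1) \<theta>(3) d(2)] Lp_on_mult_bounded[OF md bd w(2)])
    also have "Lint (\<lambda>x. \<theta>' (v k x) *\<^sub>R (grad (v k) x - W x)) \<le> L powr p * Lint (\<lambda>x. grad (v k) x - W x)"
      by (intro Lint_mult_bounded_le \<theta>(3) L d)
    finally show "Lint (\<lambda>x. \<theta>' (v k x) *\<^sub>R grad (v k) x - \<theta>' (w x) *\<^sub>R W x) \<le> 2 powr p *
      (L powr p * Lint (\<lambda>x. grad (v k) x - W x) + Lint (\<lambda>x. (\<theta>' (v k x) - \<theta>' (w x)) *\<^sub>R W x))"
      by simp
  next
    show "(\<lambda>k. 2 powr p * (L powr p * Lint (\<lambda>x. grad (v k) x - W x) + Lint (\<lambda>x. (\<theta>' (v k x) - \<theta>' (w x)) *\<^sub>R W x))) \<longlonglongrightarrow> 0"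
      by (rule tendsto_eq_intros lim(3) z refl)+ simp
  qed
qed

lemma Lp_on_lipschitz_compose:
  fixes \<theta> :: "real \<Rightarrow> real"
  assumes "\<And>t. (\<theta> has_real_derivative \<theta>' t) (at t)" "\<And>t. \<bar>\<theta>' t\<bar> \<le> L" "\<theta> 0 = 0" "Lp_on p \<Omega> w"
  shows "Lp_on p \<Omega> (\<lambda>x. \<theta> (w x))"
proof (rule Lp_on_dominated)
  have lip: "\<bar>\<theta> t\<bar> \<le> L * \<bar>t\<bar>" for t
    using field_differentiable_bound[of UNIV \<theta> \<theta>' L t 0] assms by simp
  show "integrable (lebesgue_on \<Omega>) (\<lambda>x. L powr p * norm (w x) powr p)"
    using assms by (auto simp: Lp_on_def)
  have "continuous_on UNIV \<theta>"
    using assms(1) DERIV_isCont continuous_at_imp_continuous_on by blast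
  from measurable_compose[OF Lp_on_measurable[OF assms(4)] borel_measurable_continuous_onI[OF this]]
  show "(\<lambda>x. \<theta> (w x)) \<in> borel_measurable (lebesgue_on \<Omega>)" .
  have L: "L \<ge> 0" using assms(2)[of 0] by simp
  have "\<bar>\<theta> t\<bar> powr p \<le> L powr p * \<bar>t\<bar> powr p" for t
    using lip[of t] p L by (subst powr_mult[symmetric]) (auto intro!: powr_mono2)
  then show "AE x in lebesgue_on \<Omega>. norm (\<theta> (w x)) powr p \<le> L powr p * norm (w x) powr p"
    by simp
qed

lemma sobolev_0_chain:
  fixes \<theta> :: "real \<Rightarrow> real"
  assumes \<theta>: "\<And>k. C_k k \<theta>" "\<And>t. (\<theta> has_real_derivative \<theta>' t) (at t)" "\<And>t. \<bar>\<theta>' t\<bar> \<le> L" "\<theta> 0 = 0"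
    and w: "sobolev_0 w W"
  shows "sobolev_0 (\<lambda>x. \<theta> (w x)) (\<lambda>x. \<theta>' (w x) *\<^sub>R W x)"
proof -
  note Lp = sobolev_0_Lp[OF w]
  obtain v where v: "\<And>k. v k \<in> test_functions \<Omega>"
    "AE x in lebesgue_on \<Omega>. (\<lambda>k. v k x) \<longlonglongrightarrow> w x"
    "(\<lambda>k. Lint (\<lambda>x. v k x - w x)) \<longlonglongrightarrow> 0" "(\<lambda>k. Lint (\<lambda>x. grad (v k) x - W x)) \<longlonglongrightarrow> 0"
    by (rule sobolev_0_sequence[OF w]) (rule that)
  \<comment> \<open>The condition \<open>\<theta> 0 = 0\<close> preserves compact supports.\<close>
  have t: "(\<lambda>x. \<theta> (v k x)) \<in> test_functions \<Omega>" for k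
    by (rule test_functions_multiplier[OF v(1)[of k] C_k_compose[OF \<theta>(1) test_functions_C_k[OF v(1)]]])
      (simp add: \<theta>(4))
  have g: "grad (\<lambda>x. \<theta> (v k x)) = (\<lambda>x. \<theta>' (v k x) *\<^sub>R grad (v k) x)" for k
    by (rule ext) (rule grad_compose[OF test_functions_C_k[OF v(1)] \<theta>(2)])
  have "\<theta>' \<in> borel_measurable borel"
    by (intro borel_measurable_continuous_onI C_k_real_derivative_continuous[OF \<theta>(1,2)])
  note m = measurable_compose[OF Lp_on_measurable[OF Lp(1)] this]
  note lims = chain_tendsto[OF \<theta>(1-3) Lp v]
  show ?thesis
    by (rule sobolev_0_limit[OF sobolev_0_test[OF t]])
      (use lims in \<open>auto simp: g intro!: Lp_on_lipschitz_compose[OF \<theta>(2,3,4) Lp(1)] Lp_on_mult_bounded[OF m \<theta>(3) Lp(2)]\<close>)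
qed

text \<open>The supports come from the approximations of \<open>w\<close>; the bound on
  \<open>grad b\<close> is what puts the term \<open>w x *\<^sub>R grad b x\<close> into
  L^p.\<close>

lemma sobolev_0_multiplier:
  assumes b: "\<And>k. C_k k b" "\<And>x. \<bar>b x\<bar> \<le> L" "\<And>x. norm (grad b x) \<le> L"
    and w: "sobolev_0 w W"
  shows "sobolev_0 (\<lambda>x. b x * w x) (\<lambda>x. b x *\<^sub>R W x + w x *\<^sub>R grad b x)"
proof -
  have L: "L \<ge> 0" using b(2)[of 0] by simp
  note Lp = sobolev_0_Lp[OF w]
  obtain v where v: "\<And>k. v k \<in> test_functions \<Omega>"
    "AE x in lebesgue_on \<Omega>. (\<lambda>k. v k x) \<longlonglongrightarrow> w x"
    "(\<lambda>k. Lint (\<lambda>x. v k x - w x)) \<longlonglongrightarrow> 0" "(\<lambda>k. Lint (\<lambda>x. grad (v k) x - W x)) \<longlonglongrightarrow> 0"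
    by (rule sobolev_0_sequence[OF w]) (rule that)
  have t: "(\<lambda>x. b x * v k x) \<in> test_functions \<Omega>" for k
    by (rule test_functions_multiplier[OF v(1)[of k] C_k_mult[OF b(1) test_functions_C_k[OF v(1)]]]) simp
  have g: "grad (\<lambda>x. b x * v k x) = (\<lambda>x. b x *\<^sub>R grad (v k) x + v k x *\<^sub>R grad b x)" for k
    by (rule ext) (rule grad_mult[OF b(1) test_functions_C_k[OF v(1)]])
  have mb: "b \<in> borel_measurable (lebesgue_on \<Omega>)"
    by (intro continuous_borel_measurable C_k_imp_continuous b)
  have mg: "grad b \<in> borel_measurable (lebesgue_on \<Omega>)"
    by (intro continuous_borel_measurable continuous_on_grad b)
  have prod: "Lp_on p \<Omega> (\<lambda>x. f x *\<^sub>R grad b x)" "Lint (\<lambda>x. f x *\<^sub>R grad b x) \<le> L powr p * Lint f"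
    if f: "Lp_on p \<Omega> f" for f
  proof -
    have Lf: "Lp_on p \<Omega> (\<lambda>x. L *\<^sub>R f x)"
      by (rule Lp_on_mult_bounded[OF _ _ f, of _ "\<bar>L\<bar>"]) auto
    have le: "norm (f x *\<^sub>R grad b x) \<le> norm (L *\<^sub>R f x)" for x
      using mult_left_mono[OF b(3)[of x], of "\<bar>f x\<bar>"] L by (simp add: abs_mult mult.commute)
    show "Lint (\<lambda>x. f x *\<^sub>R grad b x) \<le> L powr p * Lint f"
      using Lint_mono[OF Lf le] L Lint_scaleR[of L f] by simp
    show "Lp_on p \<Omega> (\<lambda>x. f x *\<^sub>R grad b x)"
      using le p Lp_on_measurable[OF f] mg
      by (intro Lp_on_dominated[OF _ Lp_on_integrable[OF Lf]]) (auto intro!: AE_I2 powr_mono2)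
  qed
  note mult = Lp_on_mult_bounded[OF mb b(2)]
  have d: "Lp_on p \<Omega> (\<lambda>x. v k x - w x)" "Lp_on p \<Omega> (\<lambda>x. grad (v k) x - W x)" for k
    by (intro Lp_on_diff Lp test_function_Lp v)+
  show ?thesis
  proof (rule sobolev_0_limit[OF sobolev_0_test[OF t]])
    show "Lp_on p \<Omega> (\<lambda>x. b x * w x)" using mult[OF Lp(1)] by simp
    show "Lp_on p \<Omega> (\<lambda>x. b x *\<^sub>R W x + w x *\<^sub>R grad b x)"
      by (intro Lp_on_add mult prod Lp)
    show "(\<lambda>k. Lint (\<lambda>x. b x * v k x - b x * w x)) \<longlonglongrightarrow> 0"
    proof (rule Lint_tendsto_0I)
      show "Lint (\<lambda>x. b x * v k x - b x * w x) \<le> L powr p * Lint (\<lambda>x. v k x - w x)" for k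
        using Lint_mult_bounded_le[of b L "\<lambda>x. v k x - w x"] b(2) L d(1)
        by (simp add: right_diff_distrib)
      show "(\<lambda>k. L powr p * Lint (\<lambda>x. v k x - w x)) \<longlonglongrightarrow> 0"
        using tendsto_mult_left[OF v(3)] by simp
    qed
    show "(\<lambda>k. Lint (\<lambda>x. grad (\<lambda>x. b x * v k x) x - (b x *\<^sub>R W x + w x *\<^sub>R grad b x))) \<longlonglongrightarrow> 0"
    proof (rule Lint_tendsto_0I)
      fix k
      have "Lint (\<lambda>x. grad (\<lambda>x. b x * v k x) x - (b x *\<^sub>R W x + w x *\<^sub>R grad b x))
         = Lint (\<lambda>x. b x *\<^sub>R (grad (v k) x - W x) + (v k x - w x) *\<^sub>R grad b x)"
        unfolding g by (simp add: algebra_simps)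
      also have "\<dots> \<le> 2 powr p * (Lint (\<lambda>x. b x *\<^sub>R (grad (v k) x - W x)) + Lint (\<lambda>x. (v k x - w x) *\<^sub>R grad b x))"
        by (intro Lint_add_le mult prod d)
      also have "\<dots> \<le> 2 powr p * (L powr p * Lint (\<lambda>x. grad (v k) x - W x) + L powr p * Lint (\<lambda>x. v k x - w x))"
        by (intro mult_left_mono add_mono prod d Lint_mult_bounded_le b L) simp
      finally show "Lint (\<lambda>x. grad (\<lambda>x. b x * v k x) x - (b x *\<^sub>R W x + w x *\<^sub>R grad b x))
        \<le> 2 powr p * (L powr p * Lint (\<lambda>x. grad (v k) x - W x) + L powr p * Lint (\<lambda>x. v k x - w x))" .
    next
      show "(\<lambda>k. 2 powr p * (L powr p * Lint (\<lambda>x. grad (v k) x - W x) + L powr p * Lint (\<lambda>x. v k x - w x))) \<longlonglongrightarrow> 0"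
        by (rule tendsto_eq_intros v(3,4) refl)+ simp
    qed
  qed
qed

end

section \<open>De Giorgi iteration and truncations\<close>

text \<open>Fast geometric decay: along levels with halving gaps, the surplus exponent \<delta>
  beats the growing factors 1 / (h - k), provided that the first value is below a threshold. The
  limit supplies a level where it is.\<close>

lemma de_giorgi_iteration:
  fixes m :: "real \<Rightarrow> real"
  assumes nonneg: "\<And>k. 0 \<le> m k" and anti: "\<And>h k. k \<le> h \<Longrightarrow> m h \<le> m k"
    and C: "C > 0" and \<delta>: "\<delta> > 0" and k0: "k0 > 0"
    and step: "\<And>k h. k0 \<le> k \<Longrightarrow> k < h \<Longrightarrow> (h - k) * m h \<le> C * k * m k powr (1 + \<delta>)"
    and lim: "(m \<longlongrightarrow> 0) at_top"
  shows "\<exists>M>0. m M = 0"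
proof -
  \<comment> \<open>With \<open>q powr \<delta> = 1 / 2\<close> the gain in each step exactly
    compensates the halving of the gaps.\<close>
  define q where "q = (2::real) powr (- 1 / \<delta>)"
  have q: "0 < q" "q < 1" "q powr \<delta> = 1 / 2"
    using \<delta> unfolding q_def powr_powr by (auto simp: divide_neg_pos powr_minus_divide intro!: powr_less_one)
  \<comment> \<open>Chosen so that \<open>4 * C * \<eta> powr \<delta> = q\<close>, the contraction
    that the induction for \<open>decay\<close> asks for.\<close>
  define \<eta> where "\<eta> = (q / (4 * C)) powr (1 / \<delta>)"
  have \<eta>: "\<eta> > 0" "\<eta> powr \<delta> = q / (4 * C)"
    using q C \<delta> by (auto simp: \<eta>_def powr_powr)
  have "\<forall>\<^sub>F k in at_top. k \<ge> k0 \<and> m k < \<eta>"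
    using order_tendstoD(2)[OF lim \<eta>(1)] by (intro eventually_conj eventually_ge_at_top)
  then obtain M where M: "M \<ge> k0" "m M < \<eta>"
    by (auto simp: eventually_at_top_linorder)
  have Mpos: "M > 0" using M k0 by linarith
  \<comment> \<open>All levels stay between M and 2 M. The factor k on the right of
    \<open>step\<close> is then at most 2 M, and M cancels against the gap M / 2^(j+1).\<close>
  define k where "k j = M * (2 - (1/2) ^ j)" for j :: nat
  have k_ge: "M \<le> k j" and k_le: "k j \<le> 2 * M" for j
    using Mpos power_le_one[of "1/2::real" j] by (auto simp: k_def algebra_simps)
  have k_diff: "k (Suc j) - k j = M * (1/2) ^ Suc j" for j
    by (simp add: k_def algebra_simps)
  have k_less: "k j < k (Suc j)" for j
    using k_diff[of j] Mpos by (smt (verit) mult_pos_pos zero_less_power zero_less_divide_1_iff)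
  have decay: "m (k j) \<le> m M * q ^ j" for j
  proof (induction j)
    case 0
    then show ?case by (simp add: k_def)
  next
    case (Suc j)
    show ?case
    proof (cases "m M = 0")
      case True
      then show ?thesis using anti[OF k_ge[of "Suc j"]] nonneg by simp
    next
      case False
      then have m0: "m M > 0" using nonneg[of M] by simp
      have "M * (1/2) ^ Suc j * m (k (Suc j)) \<le> C * k j * m (k j) powr (1 + \<delta>)"
        using step[OF _ k_less[of j]] k_ge[of j] M(1) unfolding k_diff by linarith
      also have "\<dots> \<le> C * (2 * M) * (m M * q ^ j) powr (1 + \<delta>)"
        using C k_le[of j] Suc nonneg[of "k j"] k_ge[of j] Mpos \<delta> by (intro mult_mono powr_mono2) auto
      also have "(m M * q ^ j) powr (1 + \<delta>) = m M * q ^ j * (m M powr \<delta> * (q powr \<delta>) ^ j)"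
        using m0 q(1) by (simp add: powr_add powr_mult powr_power powr_realpow[symmetric] powr_powr mult.commute)
      also have "C * (2 * M) * (m M * q ^ j * (m M powr \<delta> * (q powr \<delta>) ^ j))
         = M * (1/2) ^ Suc j * (m M * q ^ j * (4 * C * m M powr \<delta>))"
        by (simp add: q(3) power_one_over field_simps)
      finally have "m (k (Suc j)) \<le> m M * q ^ j * (4 * C * m M powr \<delta>)"
        using Mpos by (subst (asm) mult_le_cancel_left_pos) auto
      also have "m M powr \<delta> \<le> \<eta> powr \<delta>"
        using M m0 \<delta> by (intro powr_mono2) auto
      also have "4 * C * \<eta> powr \<delta> = q" using C by (simp add: \<eta>)
      finally show ?thesis using C m0 q by (simp add: mult.assoc mult.left_commute[of q] mult.commute[of _ q] mult_left_mono)
    qed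
  qed
  have "m (2 * M) \<le> m M * q ^ j" for j
    using anti[OF k_le[of j]] decay[of j] by linarith
  moreover have "(\<lambda>j. m M * q ^ j) \<longlonglongrightarrow> 0"
    using q by (intro tendsto_mult_right_zero LIMSEQ_realpow_zero) auto
  ultimately have "m (2 * M) \<le> 0"
    by (intro tendsto_lowerbound[of _ _ sequentially]) auto
  then show ?thesis using nonneg[of "2 * M"] Mpos by (intro exI[of _ "2 * M"]) auto
qed

text \<open>A smooth replacement for \<open>max 0 (t - k)\<close> that vanishes exactly for \<open>t \<le> k\<close>, with
  derivative between \<open>0\<close> and \<open>2\<close> for every \<open>e > 0\<close>.\<close>

definition soft_trunc :: "real \<Rightarrow> real \<Rightarrow> real \<Rightarrow> real" where
  "soft_trunc k e t = (t - k) * flat 0 ((t - k) / e)"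

lemma C_k_soft_trunc: "C_k j (soft_trunc k e)"
  unfolding soft_trunc_def[abs_def] divide_inverse
  by (rule C_k_mult[OF _ C_k_compose[OF C_k_flat]])
    (auto intro!: C_k_diff C_k_mult C_k_const C_k_inner_left[where c = "1::real", simplified])

lemma has_real_derivative_soft_trunc:
  assumes "e > 0"
  shows "(soft_trunc k e has_real_derivative flat 0 ((t - k) / e) + flat 1 ((t - k) / e)) (at t)"
proof -
  have "(soft_trunc k e has_real_derivative
     flat 0 ((t - k) / e) + flat (Suc (Suc 0)) ((t - k) / e) * (1 / e) * (t - k)) (at t)"
    unfolding soft_trunc_def[abs_def]
  proof (rule DERIV_cong[OF DERIV_mult[OF _ DERIV_chain2[OF has_real_derivative_flat]]])
    show "((\<lambda>t. t - k) has_real_derivative 1) (at t)"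
      by (auto intro!: derivative_eq_intros)
    show "((\<lambda>t. (t - k) / e) has_real_derivative 1 / e) (at t)"
      using assms by (auto intro!: derivative_eq_intros)
  qed simp
  moreover have "flat (Suc (Suc 0)) ((t - k) / e) * (1 / e) * (t - k) = flat 1 ((t - k) / e)"
    using flat_Suc[of "(t - k) / e" "Suc 0"] by (simp add: mult.commute)
  ultimately show ?thesis by simp
qed

lemma soft_trunc_derivative_bounds:
  "0 \<le> flat 0 s + flat 1 s" "flat 0 s + flat 1 s \<le> 2"
  using flat_nonneg[of 0 s] flat_nonneg[of 1 s] flat_le[of 0 s] flat_le[of 1 s] by auto

lemma soft_trunc_eq_0: "e > 0 \<Longrightarrow> t \<le> k \<Longrightarrow> soft_trunc k e t = 0"
  by (simp add: soft_trunc_def flat_nonpos divide_nonpos_pos)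

lemma soft_trunc_bounds:
  assumes "e > 0"
  shows "0 \<le> soft_trunc k e t" "soft_trunc k e t \<le> max 0 (t - k)"
proof -
  have "0 \<le> soft_trunc k e t \<and> soft_trunc k e t \<le> max 0 (t - k)"
  proof (cases "t \<le> k")
    case False
    then show ?thesis
      using flat_le[of 0 "(t - k) / e"] flat_nonneg[of 0 "(t - k) / e"] mult_left_mono[of "flat 0 ((t - k) / e)" 1 "t - k"]
      by (auto simp: soft_trunc_def)
  qed (use assms in \<open>simp add: soft_trunc_eq_0\<close>)
  then show "0 \<le> soft_trunc k e t" "soft_trunc k e t \<le> max 0 (t - k)" by auto
qed

text \<open>The numerator varies because on a nodal domain the level of the truncation tends to 0
  together with its scale.\<close>

lemma flat_0_tendsto_1:
  assumes "s \<longlonglongrightarrow> t" "t > 0" "e \<longlonglongrightarrow> 0" "\<And>j::nat. e j > 0"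
  shows "(\<lambda>j. flat 0 (s j / e j)) \<longlonglongrightarrow> 1"
proof -
  have "(\<lambda>j. exp (- (e j / s j))) \<longlonglongrightarrow> exp (- (0 / t))"
    using assms by (intro tendsto_intros) auto
  moreover have "\<forall>\<^sub>F j in sequentially. exp (- (e j / s j)) = flat 0 (s j / e j)"
    using order_tendstoD(1)[OF assms(1,2)]
  proof eventually_elim
    case (elim j)
    then show ?case using assms(4)[of j] by (simp add: flat_def zero_less_divide_iff not_le)
  qed
  ultimately show ?thesis by (simp add: tendsto_cong)
qed

lemma soft_trunc_tendsto:
  assumes "e \<longlonglongrightarrow> 0" "\<And>j::nat. e j > 0"
  shows "(\<lambda>j. soft_trunc k (e j) t) \<longlonglongrightarrow> max 0 (t - k)"
proof (cases "t \<le> k")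
  case False
  have "(\<lambda>j. (t - k) * flat 0 ((t - k) / e j)) \<longlonglongrightarrow> (t - k) * 1"
    using False assms by (intro tendsto_mult_left flat_0_tendsto_1[OF tendsto_const]) auto
  then show ?thesis using False by (simp add: soft_trunc_def)
qed (use assms in \<open>simp add: soft_trunc_eq_0\<close>)

section \<open>The Poincare inequality in terms of measure, and dominated limits\<close>

context bounded_domain
begin

lemma emeasure_subset_finite:
  assumes "S \<subseteq> \<Omega>"
  shows "emeasure lborel S = ennreal (measure lborel S)"
  using emeasure_bounded_finite[OF bounded_subset[OF bounded_domain assms]]
  by (intro emeasure_eq_ennreal_measure) auto

lemma Lint_eq_0:
  assumes "AE x in lebesgue_on \<Omega>. f x = 0"
  shows "Lint f = 0"
  unfolding Lint_def
  using assms p by (intro integral_eq_zero_AE) (auto elim!: AE_mp)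

lemma AE_lebesgue_on_null:
  assumes "S \<in> sets borel" "S \<subseteq> \<Omega>" "measure lborel S = 0"
  shows "AE x in lebesgue_on \<Omega>. x \<notin> S"
proof -
  have "emeasure lborel S = 0" using emeasure_subset_finite[OF assms(2)] assms(3) by simp
  then have "S \<in> null_sets lborel" using assms(1) by auto
  then have "AE x in lborel. x \<notin> S" by (rule AE_not_in)
  then have "AE x in lebesgue. x \<notin> S" by (rule AE_completion)
  then show ?thesis by (auto simp: AE_restrict_space_iff)
qed

lemma poincare_measure:
  obtains K where "K > 0"
    "\<And>w W S. sobolev_0 w W \<Longrightarrow> S \<in> sets borel \<Longrightarrow> S \<subseteq> \<Omega> \<Longrightarrow> (\<And>x. x \<in> \<Omega> \<Longrightarrow> x \<notin> S \<Longrightarrow> w x = 0) \<Longrightarrow>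
       Lint w \<le> K * measure lborel S powr (p / DIM('a)) * Lint W"
proof -
  define n where "n = real DIM('a)"
  have n: "n > 0" by (simp add: n_def)
  \<comment> \<open>A ball of radius \<kappa> |S|^(1/n) has volume exactly 2 |S|.\<close>
  define \<kappa> where "\<kappa> = (2 / unit_ball_vol n) powr (1 / n)"
  have c: "unit_ball_vol n > 0" using n by simp
  have \<kappa>: "\<kappa> > 0" using c by (simp add: \<kappa>_def)
  show thesis
  proof (rule that[of "2 * 16 powr p * \<kappa> powr p"])
    fix w W and S :: "'a set"
    assume w: "sobolev_0 w W" and S: "S \<in> sets borel" "S \<subseteq> \<Omega>" and v: "\<And>x. x \<in> \<Omega> \<Longrightarrow> x \<notin> S \<Longrightarrow> w x = 0"
    let ?m = "measure lborel S"
    show "Lint w \<le> 2 * 16 powr p * \<kappa> powr p * ?m powr (p / DIM('a)) * Lint W"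
    proof (cases "?m = 0")
      \<comment> \<open>The radius would be 0 here; but w vanishes almost everywhere, and both sides
        are 0.\<close>
      case True
      have "AE x in lebesgue_on \<Omega>. w x = 0"
        using AE_lebesgue_on_null[OF S True] AE_space by eventually_elim (use v in auto)
      then show ?thesis using True by (simp add: Lint_eq_0)
    next
      case False
      then have m: "?m > 0" by (simp add: zero_less_measure_iff measure_nonneg order_less_le)
      define r where "r = \<kappa> * ?m powr (1 / n)"
      have r: "r > 0" using \<kappa> m by (simp add: r_def)
      have "r ^ DIM('a) = r powr n" using r by (simp add: n_def powr_realpow)
      also have "\<dots> = 2 / unit_ball_vol n * ?m"
        using \<kappa> m c n by (simp add: r_def powr_mult powr_powr \<kappa>_def)
      finally have rn: "r ^ DIM('a) = 2 / unit_ball_vol n * ?m" .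
      have "emeasure lborel (ball (0::'a) r) = ennreal (2 * ?m)"
        using r c by (simp add: emeasure_ball rn n_def[symmetric])
      then have "2 * emeasure lborel S \<le> emeasure lborel (ball (0::'a) r)"
        by (simp add: emeasure_subset_finite[OF S(2)] ennreal_mult')
      from sobolev_0_poincare[OF w S r this v]
      show ?thesis
        using \<kappa> m by (simp add: r_def powr_mult powr_powr n_def[symmetric] mult_ac)
    qed
  qed (use \<kappa> in simp)
qed

lemma pairing_self: "pairing f f = Lint f"
proof -
  have "norm a powr (p - 2) * (a \<bullet> a) = norm a powr p" for a :: 'b
  proof (cases "a = 0")
    case False
    then have "norm a powr (p - 2) * norm a powr 2 = norm a powr p"
      by (subst powr_add[symmetric]) simp
    then show ?thesis using False by (simp add: dot_square_norm powr_numeral)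
  qed (use p in simp)
  then show ?thesis by (simp add: pairing_def Lint_def)
qed

text \<open>Pointwise |h G|^p = h^(p-1) h |G|^p, and h |G|^p is the integrand of the pairing of G
  with h G. Thus a test whose gradient is a nonnegative bounded multiple of G has its energy
  controlled by the tested equation.\<close>

lemma Lint_scaled_gradient_le:
  assumes G: "Lp_on p \<Omega> G" "Lp_on p \<Omega> (\<lambda>x. h x *\<^sub>R G x)"
    and h: "\<And>x. x \<in> \<Omega> \<Longrightarrow> 0 \<le> h x \<and> h x \<le> L"
  shows "Lint (\<lambda>x. h x *\<^sub>R G x) \<le> L powr (p - 1) * pairing G (\<lambda>x. h x *\<^sub>R G x)"
proof -
  have "norm (t *\<^sub>R a) powr p \<le> L powr (p - 1) * ((norm a powr (p - 2) *\<^sub>R a) \<bullet> (t *\<^sub>R a))"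
    if t: "0 \<le> t" "t \<le> L" for t and a :: "'b"
  proof (cases "a = 0 \<or> t = 0")
    case False
    have "norm (t *\<^sub>R a) powr p = t powr (p - 1) * (t * norm a powr p)"
      using False t by (simp add: powr_mult powr_diff)
    also have "\<dots> \<le> L powr (p - 1) * (t * norm a powr p)"
      using t p by (intro mult_right_mono powr_mono2) auto
    also have "norm a powr p = norm a powr (p - 2) * (a \<bullet> a)"
    proof -
      have "norm a powr (p - 2) * norm a powr 2 = norm a powr p"
        by (subst powr_add[symmetric]) simp
      then show ?thesis using False by (simp add: dot_square_norm powr_numeral)
    qed
    finally show ?thesis by (simp add: mult_ac)
  qed (use p in auto)
  then have "Lint (\<lambda>x. h x *\<^sub>R G x) \<le> integral\<^sup>L (lebesgue_on \<Omega>)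
      (\<lambda>x. L powr (p - 1) * ((norm (G x) powr (p - 2) *\<^sub>R G x) \<bullet> (h x *\<^sub>R G x)))"
    unfolding Lint_def
    by (intro integral_mono integrable_mult_right pairing_integrable Lp_on_integrable G) (use h in auto)
  also have "\<dots> = L powr (p - 1) * pairing G (\<lambda>x. h x *\<^sub>R G x)"
    unfolding pairing_def by (rule integral_mult_right_zero)
  finally show ?thesis .
qed

lemma Lint_tendsto_dominated:
  assumes f: "\<And>j. Lp_on p \<Omega> (f j)" and g: "Lp_on p \<Omega> g" and w: "w \<in> borel_measurable (lebesgue_on \<Omega>)"
    and le: "\<And>j x. x \<in> \<Omega> \<Longrightarrow> norm (f j x) \<le> norm (g x)"
    and lim: "\<And>x. x \<in> \<Omega> \<Longrightarrow> (\<lambda>j. f j x) \<longlonglongrightarrow> w x"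
  shows "(\<lambda>j. Lint (f j)) \<longlonglongrightarrow> Lint w"
  unfolding Lint_def
proof (rule integral_dominated_convergence)
  show "integrable (lebesgue_on \<Omega>) (\<lambda>x. norm (g x) powr p)" by (rule Lp_on_integrable[OF g])
  show "(\<lambda>x. norm (f j x) powr p) \<in> borel_measurable (lebesgue_on \<Omega>)" for j
    using Lp_on_measurable[OF f] by measurable
  show "(\<lambda>x. norm (w x) powr p) \<in> borel_measurable (lebesgue_on \<Omega>)"
    using w by measurable
  show "AE x in lebesgue_on \<Omega>. norm (norm (f j x) powr p) \<le> norm (g x) powr p" for j
    using le p by (auto intro!: AE_I2 powr_mono2)
  show "AE x in lebesgue_on \<Omega>. (\<lambda>j. norm (f j x) powr p) \<longlonglongrightarrow> norm (w x) powr p"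
    using lim p by (auto intro!: AE_I2 tendsto_powr' tendsto_norm)
qed

lemma pairing_tendsto_dominated:
  assumes u: "Lp_on p \<Omega> u" and f: "\<And>j. Lp_on p \<Omega> (f j)" and g: "Lp_on p \<Omega> g" and w: "w \<in> borel_measurable (lebesgue_on \<Omega>)"
    and le: "\<And>j x. x \<in> \<Omega> \<Longrightarrow> norm (f j x) \<le> norm (g x)"
    and lim: "\<And>x. x \<in> \<Omega> \<Longrightarrow> (\<lambda>j. f j x) \<longlonglongrightarrow> w x"
  shows "(\<lambda>j. pairing u (f j)) \<longlonglongrightarrow> pairing u w"
  unfolding pairing_def
proof (rule integral_dominated_convergence)
  show "integrable (lebesgue_on \<Omega>) (\<lambda>x. 1 * norm (u x) powr p + 1 powr (1 - p) * norm (g x) powr p)"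
    using u g by (auto simp: Lp_on_def)
  show "(\<lambda>x. (norm (u x) powr (p - 2) *\<^sub>R u x) \<bullet> f j x) \<in> borel_measurable (lebesgue_on \<Omega>)" for j
    using Lp_on_measurable[OF u] Lp_on_measurable[OF f] by measurable
  show "(\<lambda>x. (norm (u x) powr (p - 2) *\<^sub>R u x) \<bullet> w x) \<in> borel_measurable (lebesgue_on \<Omega>)"
    using Lp_on_measurable[OF u] w by measurable
  show "AE x in lebesgue_on \<Omega>. norm ((norm (u x) powr (p - 2) *\<^sub>R u x) \<bullet> f j x)
    \<le> 1 * norm (u x) powr p + 1 powr (1 - p) * norm (g x) powr p" for j
  proof (rule AE_I2)
    fix x assume "x \<in> space (lebesgue_on \<Omega>)"
    then have "norm (f j x) powr p \<le> norm (g x) powr p" using le p by (auto intro!: powr_mono2)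
    then show "norm ((norm (u x) powr (p - 2) *\<^sub>R u x) \<bullet> f j x)
      \<le> 1 * norm (u x) powr p + 1 powr (1 - p) * norm (g x) powr p"
      using pairing_pointwise[of 1 "u x" "f j x"] by simp
  qed
  show "AE x in lebesgue_on \<Omega>. (\<lambda>j. (norm (u x) powr (p - 2) *\<^sub>R u x) \<bullet> f j x) \<longlonglongrightarrow> (norm (u x) powr (p - 2) *\<^sub>R u x) \<bullet> w x"
    by (intro AE_I2 tendsto_inner tendsto_const lim) simp
qed

end

section \<open>Boundedness of eigenfunctions\<close>

text \<open>The eigenvalue problem with the gradient fixed and both integrals written as pairings.
  Continuity makes superlevel sets open; it is given inside \<Omega> and says nothing about the
  boundary.\<close>

locale p_eigenfunction = bounded_domain \<Omega> p for \<Omega> :: "'a::euclidean_space set" and p :: real +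
  fixes lam :: real and u :: "'a \<Rightarrow> real" and G :: "'a \<Rightarrow> 'a"
  assumes sobolev: "sobolev_0 u G"
    and weak: "\<And>v. v \<in> test_functions \<Omega> \<Longrightarrow> pairing G (grad v) = lam * pairing u v"
    and nontrivial: "\<not> (AE x in lebesgue_on \<Omega>. u x = 0)"
    and continuous: "continuous_on \<Omega> u"
begin

lemmas u_Lp = sobolev_0_Lp(1)[OF sobolev] and G_Lp = sobolev_0_Lp(2)[OF sobolev]

text \<open>Density of test functions and \<open>pairing_bound\<close>. The order of limits matters:
  e tends to 0 with d fixed, since \<open>d powr (1 - p)\<close> blows up, and only then does d tend
  to 0.\<close>

lemma weak_sobolev:
  assumes w: "sobolev_0 w W"
  shows "pairing G W = lam * pairing u w"
proof -
  note Lp = sobolev_0_Lp[OF w]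
  define D where "D = \<bar>pairing G W - lam * pairing u w\<bar>"
  have "D \<le> 0 + (Lint G + \<bar>lam\<bar> * Lint u) * d" if d: "d > 0" for d
  proof (rule le_if_le_add_mult_epsilon)
    fix e :: real assume "e > 0"
    then obtain v where v: "v \<in> test_functions \<Omega>" "Lint (\<lambda>x. w x - v x) < e" "Lint (\<lambda>x. W x - grad v x) < e"
      using w by (auto simp: sobolev_0_def)
    note Lv = test_function_Lp[OF v(1)]
    have "D = \<bar>pairing G (\<lambda>x. W x - grad v x) - lam * pairing u (\<lambda>x. w x - v x)\<bar>"
      using weak[OF v(1)] by (simp add: D_def pairing_diff[OF G_Lp Lp(2) Lv(2)] pairing_diff[OF u_Lp Lp(1) Lv(1)] algebra_simps)
    also have "\<dots> \<le> \<bar>pairing G (\<lambda>x. W x - grad v x)\<bar> + \<bar>lam\<bar> * \<bar>pairing u (\<lambda>x. w x - v x)\<bar>"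
      by (simp add: abs_mult[symmetric] abs_triangle_ineq4)
    also have "\<dots> \<le> (d * Lint G + d powr (1 - p) * e) + \<bar>lam\<bar> * (d * Lint u + d powr (1 - p) * e)"
    proof (intro add_mono mult_left_mono)
      show "\<bar>pairing G (\<lambda>x. W x - grad v x)\<bar> \<le> d * Lint G + d powr (1 - p) * e"
        using pairing_bound[OF G_Lp Lp_on_diff[OF Lp(2) Lv(2)] d] v(3)
        by (meson add_left_mono dual_order.trans less_imp_le mult_left_mono powr_ge_zero)
      show "\<bar>pairing u (\<lambda>x. w x - v x)\<bar> \<le> d * Lint u + d powr (1 - p) * e"
        using pairing_bound[OF u_Lp Lp_on_diff[OF Lp(1) Lv(1)] d] v(2)
        by (meson add_left_mono dual_order.trans less_imp_le mult_left_mono powr_ge_zero)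
    qed simp
    also have "\<dots> = 0 + (Lint G + \<bar>lam\<bar> * Lint u) * d + (d powr (1 - p) * (1 + \<bar>lam\<bar>)) * e"
      by (simp add: algebra_simps)
    finally show "D \<le> 0 + (Lint G + \<bar>lam\<bar> * Lint u) * d + (d powr (1 - p) * (1 + \<bar>lam\<bar>)) * e" .
  qed simp
  then have "D \<le> 0"
    by (rule le_if_le_add_mult_epsilon) (simp_all add: Lint_nonneg)
  then show ?thesis by (simp add: D_def)
qed

text \<open>The common core of the boundedness proof and of the lower bound for nodal domains. Once
  the equation has replaced the gradient term by a pairing with u, only functions dominated by |u|
  remain. Hence the limit w' needs no gradient, and the gradients h j G need not converge.\<close>

lemma energy_estimate:
  obtains K where "K > 0"
    "\<And>w w' h S L. (\<And>j::nat. sobolev_0 (w j) (\<lambda>x. h j x *\<^sub>R G x)) \<Longrightarrow>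
       (\<And>j x. x \<in> \<Omega> \<Longrightarrow> 0 \<le> h j x \<and> h j x \<le> L) \<Longrightarrow> S \<in> sets borel \<Longrightarrow> S \<subseteq> \<Omega> \<Longrightarrow>
       (\<And>j x. x \<in> \<Omega> \<Longrightarrow> x \<notin> S \<Longrightarrow> w j x = 0) \<Longrightarrow> (\<And>j x. x \<in> \<Omega> \<Longrightarrow> \<bar>w j x\<bar> \<le> \<bar>u x\<bar>) \<Longrightarrow>
       w' \<in> borel_measurable (lebesgue_on \<Omega>) \<Longrightarrow> (\<And>x. x \<in> \<Omega> \<Longrightarrow> (\<lambda>j. w j x) \<longlonglongrightarrow> w' x) \<Longrightarrow>
       Lint w' \<le> K * measure lborel S powr (p / DIM('a)) * (L powr (p - 1) * (lam * pairing u w'))"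
proof -
  obtain K where K: "K > 0"
    "\<And>w W S. sobolev_0 w W \<Longrightarrow> S \<in> sets borel \<Longrightarrow> S \<subseteq> \<Omega> \<Longrightarrow> (\<And>x. x \<in> \<Omega> \<Longrightarrow> x \<notin> S \<Longrightarrow> w x = 0) \<Longrightarrow>
       Lint w \<le> K * measure lborel S powr (p / DIM('a)) * Lint W"
    by (fact poincare_measure)
  show thesis
  proof (rule that[OF K(1)])
    fix w :: "nat \<Rightarrow> 'a \<Rightarrow> real" and w' h S and L :: real
    assume w: "\<And>j. sobolev_0 (w j) (\<lambda>x. h j x *\<^sub>R G x)"
      and h: "\<And>j x. x \<in> \<Omega> \<Longrightarrow> 0 \<le> h j x \<and> h j x \<le> L"
      and S: "S \<in> sets borel" "S \<subseteq> \<Omega>" "\<And>j x. x \<in> \<Omega> \<Longrightarrow> x \<notin> S \<Longrightarrow> w j x = 0"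
      and le: "\<And>j x. x \<in> \<Omega> \<Longrightarrow> \<bar>w j x\<bar> \<le> \<bar>u x\<bar>" and w': "w' \<in> borel_measurable (lebesgue_on \<Omega>)"
      and lim: "\<And>x. x \<in> \<Omega> \<Longrightarrow> (\<lambda>j. w j x) \<longlonglongrightarrow> w' x"
    define A where "A = K * measure lborel S powr (p / DIM('a))"
    have A: "A \<ge> 0" using K(1) by (simp add: A_def)
    have est: "Lint (w j) \<le> A * (L powr (p - 1) * (lam * pairing u (w j)))" for j
    proof -
      have "Lint (w j) \<le> A * Lint (\<lambda>x. h j x *\<^sub>R G x)"
        unfolding A_def by (rule K(2)[OF w S])
      also have "\<dots> \<le> A * (L powr (p - 1) * pairing G (\<lambda>x. h j x *\<^sub>R G x))"
        by (intro mult_left_mono A Lint_scaled_gradient_le G_Lp sobolev_0_Lp(2)[OF w] h)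
      finally show ?thesis by (simp add: weak_sobolev[OF w])
    qed
    note wLp = sobolev_0_Lp(1)[OF w]
    have "(\<lambda>j. Lint (w j)) \<longlonglongrightarrow> Lint w'"
      using Lint_tendsto_dominated[OF wLp u_Lp w' _ lim] le by simp
    moreover have "(\<lambda>j. pairing u (w j)) \<longlonglongrightarrow> pairing u w'"
      using pairing_tendsto_dominated[OF u_Lp wLp u_Lp w' _ lim] le by simp
    then have "(\<lambda>j. A * (L powr (p - 1) * (lam * pairing u (w j)))) \<longlonglongrightarrow> A * (L powr (p - 1) * (lam * pairing u w'))"
      by (intro tendsto_mult_left)
    ultimately show "Lint w' \<le> K * measure lborel S powr (p / DIM('a)) * (L powr (p - 1) * (lam * pairing u w'))"
      unfolding A_def[symmetric] by (rule LIMSEQ_le) (use est in auto)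
  qed
qed

lemma Lint_u_pos: "Lint u > 0"
proof (rule ccontr)
  assume "\<not> Lint u > 0"
  then have "Lint u = 0" using Lint_nonneg[of u] by linarith
  then have "AE x in lebesgue_on \<Omega>. norm (u x) powr p = 0"
    unfolding Lint_def using Lp_on_integrable[OF u_Lp] by (subst (asm) integral_nonneg_eq_0_iff_AE) auto
  then show False using nontrivial by simp
qed

text \<open>Testing with u itself gives Lint G = lam Lint u; if lam were not positive, the Poincare
  inequality on \<Omega> would contradict Lint u > 0.\<close>

lemma lam_pos: "lam > 0"
proof -
  obtain K where K: "K > 0"
    "\<And>w W S. sobolev_0 w W \<Longrightarrow> S \<in> sets borel \<Longrightarrow> S \<subseteq> \<Omega> \<Longrightarrow> (\<And>x. x \<in> \<Omega> \<Longrightarrow> x \<notin> S \<Longrightarrow> w x = 0) \<Longrightarrow>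
       Lint w \<le> K * measure lborel S powr (p / DIM('a)) * Lint W"
    by (fact poincare_measure)
  have "Lint u \<le> K * measure lborel \<Omega> powr (p / DIM('a)) * Lint G"
    using K(2)[OF sobolev, of \<Omega>] open_domain by (simp add: borel_open)
  also have "Lint G = lam * Lint u"
    using weak_sobolev[OF sobolev] by (simp add: pairing_self)
  finally have "0 < K * measure lborel \<Omega> powr (p / DIM('a)) * (lam * Lint u)"
    using Lint_u_pos by linarith
  moreover have "K * measure lborel \<Omega> powr (p / DIM('a)) \<ge> 0" using K(1) by simp
  ultimately have "0 < lam * Lint u"
    by (metis mult_nonneg_nonpos not_less)
  then show ?thesis using Lint_u_pos by (simp add: zero_less_mult_iff)
qed

section \<open>Superlevel sets and the upper bound for the eigenfunction\<close>

lemma open_superlevel: "open {x\<in>\<Omega>. k < u x}"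
  using continuous_open_preimage[OF continuous open_domain, of "{k<..}"]
  by (simp add: vimage_def Int_def)

lemma superlevel_energy:
  obtains C where "C > 0"
    "\<And>k. k \<ge> 0 \<Longrightarrow> Lint (\<lambda>x. max 0 (u x - k))
       \<le> C * measure lborel {x\<in>\<Omega>. k < u x} powr (p / DIM('a)) * pairing u (\<lambda>x. max 0 (u x - k))"
proof -
  obtain K where K: "K > 0"
    "\<And>w w' h S L. (\<And>j::nat. sobolev_0 (w j) (\<lambda>x. h j x *\<^sub>R G x)) \<Longrightarrow>
       (\<And>j x. x \<in> \<Omega> \<Longrightarrow> 0 \<le> h j x \<and> h j x \<le> L) \<Longrightarrow> S \<in> sets borel \<Longrightarrow> S \<subseteq> \<Omega> \<Longrightarrow>
       (\<And>j x. x \<in> \<Omega> \<Longrightarrow> x \<notin> S \<Longrightarrow> w j x = 0) \<Longrightarrow> (\<And>j x. x \<in> \<Omega> \<Longrightarrow> \<bar>w j x\<bar> \<le> \<bar>u x\<bar>) \<Longrightarrow>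
       w' \<in> borel_measurable (lebesgue_on \<Omega>) \<Longrightarrow> (\<And>x. x \<in> \<Omega> \<Longrightarrow> (\<lambda>j. w j x) \<longlonglongrightarrow> w' x) \<Longrightarrow>
       Lint w' \<le> K * measure lborel S powr (p / DIM('a)) * (L powr (p - 1) * (lam * pairing u w'))"
    by (fact energy_estimate)
  show thesis
  \<comment> \<open>The base 2 bounds the slope of the smooth truncations; \<open>lam\<close> comes
    from the equation.\<close>
  proof (rule that[of "K * (2 powr (p - 1) * lam)"])
    fix k :: real assume k: "k \<ge> 0"
    define e where "e j = inverse (real (Suc j))" for j
    have e: "e j > 0" for j by (simp add: e_def)
    have e0: "e \<longlonglongrightarrow> 0" unfolding e_def[abs_def] by (rule LIMSEQ_inverse_real_of_nat)
    define h where "h j x = flat 0 ((u x - k) / e j) + flat 1 ((u x - k) / e j)" for j x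
    have "Lint (\<lambda>x. max 0 (u x - k)) \<le> K * measure lborel {x\<in>\<Omega>. k < u x} powr (p / DIM('a))
       * (2 powr (p - 1) * (lam * pairing u (\<lambda>x. max 0 (u x - k))))"
    proof (rule K(2)[of "\<lambda>j x. soft_trunc k (e j) (u x)" h])
      show "sobolev_0 (\<lambda>x. soft_trunc k (e j) (u x)) (\<lambda>x. h j x *\<^sub>R G x)" for j
        unfolding h_def
        by (rule sobolev_0_chain[where L = 2 and \<theta> = "soft_trunc k (e j)"
              and \<theta>' = "\<lambda>t. flat 0 ((t - k) / e j) + flat 1 ((t - k) / e j)",
              OF C_k_soft_trunc has_real_derivative_soft_trunc[OF e] _ _ sobolev])
          (use soft_trunc_derivative_bounds soft_trunc_eq_0[OF e k] in auto)
      show "0 \<le> h j x \<and> h j x \<le> 2" for j x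
        using soft_trunc_derivative_bounds by (simp add: h_def)
      show "\<bar>soft_trunc k (e j) (u x)\<bar> \<le> \<bar>u x\<bar>" for j x
        using soft_trunc_bounds[OF e, of k j "u x"] k by auto
      show "(\<lambda>j. soft_trunc k (e j) (u x)) \<longlonglongrightarrow> max 0 (u x - k)" for x
        by (rule soft_trunc_tendsto[OF e0 e])
      show "(\<lambda>x. max 0 (u x - k)) \<in> borel_measurable (lebesgue_on \<Omega>)"
        using Lp_on_measurable[OF u_Lp] by measurable
    qed (use soft_trunc_eq_0[OF e] open_superlevel in \<open>auto simp: borel_open\<close>)
    then show "Lint (\<lambda>x. max 0 (u x - k)) \<le> K * (2 powr (p - 1) * lam)
       * measure lborel {x\<in>\<Omega>. k < u x} powr (p / DIM('a)) * pairing u (\<lambda>x. max 0 (u x - k))"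
      by (simp add: mult_ac)
  qed (use K lam_pos in simp)
qed

text \<open>The integral I of the truncation links its energy to the measures of superlevel sets:
  Young's inequality against the indicator bounds I from above, Chebyshev's inequality bounds it
  from below at higher levels, and writing u = W + k where W > 0 expresses the pairing by Lint W and
  I.\<close>

lemma integral_superlevel_bounds:
  assumes k: "k \<ge> 0"
  defines "W \<equiv> \<lambda>x. max 0 (u x - k)" and "m \<equiv> measure lborel {x\<in>\<Omega>. k < u x}"
  defines "I \<equiv> integral\<^sup>L (lebesgue_on \<Omega>) W"
  shows "Lp_on p \<Omega> W" "integrable (lebesgue_on \<Omega>) W" "I \<ge> 0"
    and "\<And>\<tau>. \<tau> > 0 \<Longrightarrow> I \<le> \<tau> * m + \<tau> powr (1 - p) * Lint W"
    and "\<And>h. k \<le> h \<Longrightarrow> (h - k) * measure lborel {x\<in>\<Omega>. h < u x} \<le> I"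
    and "pairing u W \<le> 2 powr (p - 1) * (Lint W + k powr (p - 1) * I)"
proof -
  have Wm: "W \<in> borel_measurable (lebesgue_on \<Omega>)"
    using Lp_on_measurable[OF u_Lp] unfolding W_def by measurable
  show WLp: "Lp_on p \<Omega> W"
    using k p by (intro Lp_on_dominated[OF Wm Lp_on_integrable[OF u_Lp]])
      (auto simp: W_def intro!: AE_I2 powr_mono2)
  have ind: "indicator {x\<in>\<Omega>. h < u x} \<in> borel_measurable (lebesgue_on \<Omega>)" for h
    using open_superlevel by (intro borel_measurable_lebesgue_on borel_measurable_indicator borel_open)
  have int_ind: "integrable (lebesgue_on \<Omega>) (indicator {x\<in>\<Omega>. h < u x} :: 'a \<Rightarrow> real)" for h
    by (rule finite_measure.integrable_const_bound[OF finite_measure_domain _ ind, where B = 1])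
      (auto simp: indicator_def)
  have meas: "measure (lebesgue_on \<Omega>) ({x\<in>\<Omega>. h < u x} \<inter> \<Omega>) = measure lborel {x\<in>\<Omega>. h < u x}" for h
  proof -
    have "{x\<in>\<Omega>. h < u x} \<inter> \<Omega> = {x\<in>\<Omega>. h < u x}" by auto
    then show ?thesis
      using open_superlevel[of h] by (simp add: measure_restrict_space borel_open)
  qed
  have pt: "W x \<le> \<tau> * indicator {x\<in>\<Omega>. k < u x} x + \<tau> powr (1 - p) * norm (W x) powr p"
    if "\<tau> > 0" "x \<in> \<Omega>" for \<tau> x
  proof (cases "k < u x")
    case True
    then show ?thesis
      using powr_minus_one_mult_le[of 1 "W x" \<tau> p] that p by (simp add: W_def)
  qed (simp add: W_def)
  have bint: "integrable (lebesgue_on \<Omega>) (\<lambda>x. \<tau> * indicator {x\<in>\<Omega>. k < u x} x + \<tau> powr (1 - p) * norm (W x) powr p)" for \<tau>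
    using int_ind[of k] Lp_on_integrable[OF WLp]
    by (intro Bochner_Integration.integrable_add integrable_mult_right) auto
  show Wint: "integrable (lebesgue_on \<Omega>) W"
    by (rule Bochner_Integration.integrable_bound[OF bint[of 1] Wm])
      (use pt[of 1] in \<open>force intro!: AE_I2 simp: W_def\<close>)
  show "I \<ge> 0" unfolding I_def by (rule integral_nonneg_AE) (simp add: W_def)
  show "I \<le> \<tau> * m + \<tau> powr (1 - p) * Lint W" if \<tau>: "\<tau> > 0" for \<tau>
  proof -
    have "I \<le> integral\<^sup>L (lebesgue_on \<Omega>) (\<lambda>x. \<tau> * indicator {x\<in>\<Omega>. k < u x} x + \<tau> powr (1 - p) * norm (W x) powr p)"
      unfolding I_def using pt[OF \<tau>] by (intro integral_mono Wint bint) auto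
    also have "\<dots> = \<tau> * m + \<tau> powr (1 - p) * Lint W"
      using int_ind[of k] Lp_on_integrable[OF WLp]
      by (subst Bochner_Integration.integral_add) (auto simp: meas m_def Lint_def)
    finally show ?thesis .
  qed
  show "(h - k) * measure lborel {x\<in>\<Omega>. h < u x} \<le> I" if "k \<le> h" for h
  proof -
    have "(h - k) * measure lborel {x\<in>\<Omega>. h < u x} = integral\<^sup>L (lebesgue_on \<Omega>) (\<lambda>x. (h - k) * indicator {x\<in>\<Omega>. h < u x} x)"
      by (simp add: meas)
    also have "\<dots> \<le> I"
      unfolding I_def using that
      by (intro integral_mono Wint integrable_mult_right int_ind) (auto simp: W_def indicator_def)
    finally show ?thesis .
  qed
  have "pairing u W \<le> integral\<^sup>L (lebesgue_on \<Omega>) (\<lambda>x. 2 powr (p - 1) * (norm (W x) powr p + k powr (p - 1) * W x))"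
    unfolding pairing_def
  proof (intro integral_mono pairing_integrable u_Lp WLp)
    show "integrable (lebesgue_on \<Omega>) (\<lambda>x. 2 powr (p - 1) * (norm (W x) powr p + k powr (p - 1) * W x))"
      using Wint Lp_on_integrable[OF WLp] by auto
    fix x
    show "(norm (u x) powr (p - 2) *\<^sub>R u x) \<bullet> W x \<le> 2 powr (p - 1) * (norm (W x) powr p + k powr (p - 1) * W x)"
    proof (cases "k < u x")
      case True
      then have W: "W x > 0" "u x = W x + k" by (auto simp: W_def)
      have "(norm (u x) powr (p - 2) *\<^sub>R u x) \<bullet> W x = u x powr (p - 1) * W x"
        using norm_powr_scaleR[of "u x"] True k by (simp add: abs_mult)
      also have "\<dots> \<le> 2 powr (p - 1) * (W x powr (p - 1) + k powr (p - 1)) * W x"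
        using norm_add_powr_le[of "p - 1" "W x" k] W p k by (intro mult_right_mono) auto
      also have "\<dots> = 2 powr (p - 1) * (W x powr (p - 1) * W x + k powr (p - 1) * W x)"
        by (simp add: algebra_simps)
      also have "W x powr (p - 1) * W x = norm (W x) powr p"
        using powr_mult_base[of "W x" "p - 1"] W by (simp add: mult.commute)
      finally show ?thesis .
    qed (simp add: W_def)
  qed
  also have "\<dots> = 2 powr (p - 1) * (Lint W + k powr (p - 1) * I)"
    using Wint Lp_on_integrable[OF WLp] by (simp add: Lint_def I_def)
  finally show "pairing u W \<le> 2 powr (p - 1) * (Lint W + k powr (p - 1) * I)" .
qed

lemma measure_superlevel_antimono:
  assumes "k \<le> h"
  shows "measure lborel {x\<in>\<Omega>. h < u x} \<le> measure lborel {x\<in>\<Omega>. k < u x}"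
  unfolding measure_def
  using assms open_superlevel[of k] open_superlevel[of h] emeasure_subset_finite[of "{x\<in>\<Omega>. k < u x}"]
  by (intro enn2real_mono emeasure_mono) (auto simp: borel_open less_top[symmetric])

text \<open>Chebyshev's inequality for the positive part of u, that is, the previous bounds at level
  0.\<close>

lemma measure_superlevel_tendsto_0:
  "((\<lambda>k. measure lborel {x\<in>\<Omega>. k < u x}) \<longlongrightarrow> 0) at_top"
proof -
  define I where "I = integral\<^sup>L (lebesgue_on \<Omega>) (\<lambda>x. max 0 (u x - 0))"
  have le: "\<forall>\<^sub>F k in at_top. measure lborel {x\<in>\<Omega>. k < u x} \<le> I / k"
    using eventually_gt_at_top[of 0]
  proof eventually_elim
    case (elim k)
    then show ?case
      using integral_superlevel_bounds(5)[of 0 k] by (simp add: I_def field_simps)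
  qed
  have "((\<lambda>k. I / k) \<longlongrightarrow> 0) at_top"
    by (rule tendsto_divide_0[OF tendsto_const filterlim_at_top_imp_at_infinity[OF filterlim_ident]])
  then show ?thesis
    by (intro tendsto_sandwich[OF _ le tendsto_const]) auto
qed

lemma bounded_above: "\<exists>M>0. \<forall>x\<in>\<Omega>. u x \<le> M"
proof -
  define m where "m k = measure lborel {x\<in>\<Omega>. k < u x}" for k
  define n where "n = real DIM('a)"
  have n: "n > 0" by (simp add: n_def)
  obtain C0 where C0: "C0 > 0" "\<And>k. k \<ge> 0 \<Longrightarrow> Lint (\<lambda>x. max 0 (u x - k))
       \<le> C0 * m k powr (p / n) * pairing u (\<lambda>x. max 0 (u x - k))"
    by (rule superlevel_energy) (simp add: m_def n_def that)
  define C1 where "C1 = C0 * 2 powr (p - 1)"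
  have C1: "C1 > 0" using C0 by (simp add: C1_def)
  \<comment> \<open>Choosing \<tau> below requires a (p-1)-th root, which turns
    \<open>m k powr (p / n)\<close> into \<open>m k powr \<delta>\<close>.\<close>
  define \<delta> where "\<delta> = p / (n * (p - 1))"
  have \<delta>: "\<delta> > 0" "\<delta> * (p - 1) = p / n" using p n by (auto simp: \<delta>_def field_simps)
  have m: "m k \<ge> 0" for k by (simp add: m_def)
  \<comment> \<open>For large k the factor \<open>C1 * m k powr (p / n)\<close> is below 1/2, so
    that the \<open>Lint W\<close> arising on the right can be absorbed on the left.\<close>
  have "((\<lambda>k. m k powr (p / n)) \<longlongrightarrow> 0 powr (p / n)) at_top"
    using measure_superlevel_tendsto_0 p n m
    by (intro tendsto_powr') (auto simp: m_def[abs_def])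
  then have "\<forall>\<^sub>F k in at_top. m k powr (p / n) < 1 / (2 * C1)"
    using C1 by (intro order_tendstoD(2)) auto
  then obtain k0 where k0: "\<And>k. k \<ge> k0 \<Longrightarrow> m k powr (p / n) < 1 / (2 * C1)"
    by (auto simp: eventually_at_top_linorder)
  define c where "c = 2 * (4 * C1) powr (1 / (p - 1))"
  have step: "(h - k) * m h \<le> c * k * m k powr (1 + \<delta>)" if k: "max k0 1 \<le> k" "k < h" for k h
  proof -
    define W where "W x = max 0 (u x - k)" for x
    define I where "I = integral\<^sup>L (lebesgue_on \<Omega>) W"
    have kpos: "k > 0" using k by linarith
    note b = integral_superlevel_bounds[OF less_imp_le[OF kpos], folded W_def[abs_def] I_def m_def]
    have "Lint W \<le> C0 * m k powr (p / n) * pairing u W"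
      using C0(2)[of k] kpos by (simp add: W_def[abs_def])
    also have "\<dots> \<le> C0 * m k powr (p / n) * (2 powr (p - 1) * (Lint W + k powr (p - 1) * I))"
      using C0(1) by (intro mult_left_mono b) auto
    also have "\<dots> = C1 * m k powr (p / n) * Lint W + C1 * m k powr (p / n) * (k powr (p - 1) * I)"
      by (simp add: C1_def algebra_simps)
    also have "C1 * m k powr (p / n) * Lint W \<le> 1 / 2 * Lint W"
      using k0[of k] k C1 by (intro mult_right_mono Lint_nonneg) (auto simp: field_simps)
    finally have W: "Lint W \<le> 2 * C1 * m k powr (p / n) * (k powr (p - 1) * I)" by simp
    have "I \<le> c * k * m k powr (1 + \<delta>)"
    proof (cases "m k = 0")
      \<comment> \<open>The \<tau> of the other case would be 0; but \<open>W\<close> gives Lint W =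
        0, so that \<tau> = 1 already yields I \<le> 0.\<close>
      case True
      then show ?thesis using b(4)[of 1] W p n by simp
    next
      case False
      then have mpos: "m k > 0" using m[of k] by simp
      \<comment> \<open>The value for which \<tau>^(1-p) times the bound on Lint W equals I / 2.
        Absorbing this half leaves I \<le> 2 \<tau> m k, which has the superlinear form in m
        k.\<close>
      define \<tau> where "\<tau> = (4 * C1) powr (1 / (p - 1)) * k * m k powr \<delta>"
      have \<tau>: "\<tau> > 0" using C1 kpos mpos by (simp add: \<tau>_def)
      have "\<tau> powr (p - 1) = 4 * C1 * k powr (p - 1) * m k powr (p / n)"
        using C1 kpos mpos p by (simp add: \<tau>_def powr_mult powr_powr \<delta>)
      then have "\<tau> powr (1 - p) * (4 * C1 * k powr (p - 1) * m k powr (p / n)) = 1"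
        using \<tau> by (metis powr_minus_divide minus_diff_eq nonzero_divide_eq_eq powr_gt_zero order_less_irrefl less_numeral_extra(3))
      then have half: "\<tau> powr (1 - p) * (2 * C1 * m k powr (p / n) * (k powr (p - 1) * I)) = I / 2"
        by (simp add: mult_ac)
      have "I \<le> \<tau> * m k + \<tau> powr (1 - p) * Lint W" by (rule b(4)[OF \<tau>])
      also have "\<tau> powr (1 - p) * Lint W \<le> \<tau> powr (1 - p) * (2 * C1 * m k powr (p / n) * (k powr (p - 1) * I))"
        by (intro mult_left_mono W) simp
      finally have "I \<le> 2 * \<tau> * m k" using half by simp
      also have "\<dots> = c * k * m k powr (1 + \<delta>)"
        using mpos by (simp add: c_def \<tau>_def powr_add)
      finally show ?thesis .
    qed
    then show ?thesis using b(5)[of h] k by (simp add: m_def)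
  qed
  have "\<exists>M>0. m M = 0"
    by (rule de_giorgi_iteration[of m c \<delta> "max k0 1", OF m _ _ \<delta>(1) _ step])
      (use measure_superlevel_antimono measure_superlevel_tendsto_0 C1 in \<open>auto simp: m_def[abs_def] c_def\<close>)
  then obtain M where M: "M > 0" "m M = 0" by blast
  \<comment> \<open>The superlevel set is open, so being null it is empty: the bound holds at every
    point.\<close>
  have "emeasure lborel {x\<in>\<Omega>. M < u x} = 0"
    using M(2) emeasure_subset_finite[of "{x\<in>\<Omega>. M < u x}"] by (simp add: m_def)
  then have "{x\<in>\<Omega>. M < u x} \<in> null_sets lborel"
    using open_superlevel by (auto simp: borel_open)
  then have "negligible {x\<in>\<Omega>. M < u x}"
    by (simp add: negligible_iff_null_sets null_sets_completionI)
  then have "{x\<in>\<Omega>. M < u x} = {}"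
    using open_not_negligible[OF open_superlevel] by blast
  then show ?thesis using M(1) by (intro exI[of _ M]) (auto simp: not_less)
qed

text \<open>The equation is odd, so that results on the positive part of u carry over to the
  negative part. Membership in the closure is the product rule with the constant factor -1.\<close>

lemma p_eigenfunction_uminus: "p_eigenfunction \<Omega> p lam (\<lambda>x. - u x) (\<lambda>x. - G x)"
proof unfold_locales
  have "sobolev_0 (\<lambda>x. - 1 * u x) (\<lambda>x. - 1 *\<^sub>R G x + u x *\<^sub>R grad (\<lambda>x. - 1) x)"
    by (rule sobolev_0_multiplier[OF C_k_const _ _ sobolev, of _ 1])
      (auto simp: grad_eqI[of "\<lambda>x. -1" 0])
  then show "sobolev_0 (\<lambda>x. - u x) (\<lambda>x. - G x)"
    by (simp add: grad_eqI[of "\<lambda>x. -1" 0])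
  show "pairing (\<lambda>x. - G x) (grad v) = lam * pairing (\<lambda>x. - u x) v" if "v \<in> test_functions \<Omega>" for v
    using weak[OF that] by (simp add: pairing_def)
qed (use nontrivial continuous in \<open>auto intro: continuous_intros\<close>)

lemma bounded_eigenfunction: "\<exists>M>0. \<forall>x\<in>\<Omega>. \<bar>u x\<bar> \<le> M"
proof -
  obtain M where M: "M > 0" "\<forall>x\<in>\<Omega>. u x \<le> M" using bounded_above by blast
  obtain N where N: "\<forall>x\<in>\<Omega>. - u x \<le> N"
    using p_eigenfunction.bounded_above[OF p_eigenfunction_uminus] by blast
  show ?thesis using M N by (intro exI[of _ "max M N"]) (auto simp: abs_if le_max_iff_disj)
qed

end

section \<open>Nodal domains\<close>

text \<open>A finite sum of bumps on balls inside A that cover C is positive on C, hence bounded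
  below there by some d > 0. Composing it with a smooth profile that is constant above d flattens it
  to 1 on C.\<close>

lemma smooth_cutoff:
  fixes C A :: "'a::euclidean_space set"
  assumes C: "compact C" and A: "open A" "C \<subseteq> A"
  obtains \<zeta> :: "'a \<Rightarrow> real" where "\<And>k. C_k k \<zeta>" "\<And>x. 0 \<le> \<zeta> x" "\<And>x. \<zeta> x \<le> 1"
    "\<And>x. x \<in> C \<Longrightarrow> \<zeta> x = 1" "\<And>x. x \<notin> A \<Longrightarrow> \<zeta> x = 0"
proof -
  have "\<exists>r>0. ball c r \<subseteq> A" if "c \<in> C" for c
    using that A open_contains_ball by blast
  then obtain r where r: "\<And>c. c \<in> C \<Longrightarrow> r c > 0" "\<And>c. c \<in> C \<Longrightarrow> ball c (r c) \<subseteq> A"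
    by metis
  have cover: "C \<subseteq> (\<Union>c\<in>C. ball c (r c))" using r(1) by force
  obtain D where D: "D \<subseteq> C" "finite D" "C \<subseteq> (\<Union>c\<in>D. ball c (r c))"
    by (rule compactE_image[OF C _ cover]) auto
  \<comment> \<open>Squared radius minus squared distance to c, expanded so that it is visibly
    polynomial in x.\<close>
  define q where "q c x = (r c)\<^sup>2 - (x \<bullet> x - 2 * (x \<bullet> c) + c \<bullet> c)" for c x
  have q: "q c x > 0 \<longleftrightarrow> x \<in> ball c (r c)" if "c \<in> C" for c x
  proof -
    have "q c x = (r c)\<^sup>2 - (dist c x)\<^sup>2"
      by (simp add: q_def dist_norm power2_norm_eq_inner inner_diff_left inner_diff_right inner_commute)
    then show ?thesis using r(1)[OF that] by (simp add: power_mono_iff abs_le_square_iff[symmetric] flip: not_le)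
  qed
  define B where "B x = (\<Sum>c\<in>D. flat 0 (q c x))" for x
  have q_smooth: "C_k k (q c)" for k c
    unfolding q_def[abs_def]
    by (intro C_k_diff C_k_add C_k_mult C_k_const C_k_inner_left C_k_inner_self)
  have B_smooth: "C_k k B" for k
    unfolding B_def[abs_def] by (intro C_k_sum C_k_compose[OF C_k_flat q_smooth])
  have B_nonneg: "B x \<ge> 0" for x
    unfolding B_def by (intro sum_nonneg flat_nonneg)
  have B_zero: "B x = 0" if "x \<notin> A" for x
    unfolding B_def
  proof (rule sum.neutral, rule ballI)
    fix c assume "c \<in> D"
    then have "\<not> q c x > 0" using q r(2) D(1) that by blast
    then show "flat 0 (q c x) = 0" by (simp add: flat_nonpos)
  qed
  have B_pos: "B x > 0" if x: "x \<in> C" for x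
  proof -
    obtain c where c: "c \<in> D" "x \<in> ball c (r c)" using D(3) x by blast
    then have "q c x > 0" using q D(1) by blast
    then have "flat 0 (q c x) > 0" by (simp add: flat_def)
    then show ?thesis unfolding B_def using c(1) D(2) by (intro sum_pos2[of _ c] flat_nonneg) auto
  qed
  obtain d where d: "d > 0" "\<And>x. x \<in> C \<Longrightarrow> d \<le> B x"
  proof (cases "C = {}")
    case False
    obtain y where "y \<in> C" "\<And>x. x \<in> C \<Longrightarrow> B y \<le> B x"
      using continuous_attains_inf[OF C False, of B] C_k_imp_continuous[OF B_smooth] by blast
    then show thesis using B_pos by (intro that[of "B y"]) auto
  qed (use that[of 1] in auto)
  \<comment> \<open>Where B \<ge> d the argument of \<open>flat 0\<close> is at most 0, which gives
    1; where B = 0 it is 1, and \<open>flat 0 1 = exp (- 1)\<close> gives 0.\<close>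
  define \<zeta> where "\<zeta> x = 1 - exp 1 * flat 0 (1 - inverse d * B x)" for x
  have flat_1: "flat 0 s \<le> exp (- 1)" if "s \<le> 1" for s
    using that one_le_inverse[of s] by (auto simp: flat_def)
  show thesis
  proof (rule that[of \<zeta>])
    show "C_k k \<zeta>" for k
      unfolding \<zeta>_def[abs_def]
      by (rule C_k_diff[OF C_k_const C_k_mult[OF C_k_const C_k_compose[OF C_k_flat]]])
        (intro C_k_diff C_k_mult C_k_const B_smooth)
    show "0 \<le> \<zeta> x" for x
    proof -
      have "exp 1 * flat 0 (1 - inverse d * B x) \<le> exp 1 * exp (- 1)"
        using B_nonneg[of x] d(1) by (intro mult_left_mono flat_1) auto
      then show ?thesis by (simp add: \<zeta>_def exp_minus)
    qed
    show "\<zeta> x \<le> 1" for x using flat_nonneg by (simp add: \<zeta>_def)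
    show "\<zeta> x = 1" if "x \<in> C" for x
      using d(1) d(2)[OF that] by (simp add: \<zeta>_def flat_nonpos field_simps)
    show "\<zeta> x = 0" if "x \<notin> A" for x
      using B_zero[OF that] by (simp add: \<zeta>_def flat_def exp_minus)
  qed
qed

text \<open>A cutoff with values in [0,1] has an extremum wherever it equals 0 or 1, so its value
  alone shows that its gradient vanishes.\<close>

lemma grad_eq_0_at_extremum:
  assumes "C_k (Suc 0) f" "(\<forall>y. f y \<le> f x) \<or> (\<forall>y. f x \<le> f y)"
  shows "grad f x = 0"
proof -
  have "(\<lambda>h. grad f x \<bullet> h) = (\<lambda>h. 0)"
    using differential_zero_maxmin[OF UNIV_I open_UNIV has_derivative_grad[OF assms(1)]] assms(2) by blast
  then show ?thesis by (metis inner_eq_zero_iff)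
qed

text \<open>A small ball around x inside the nonzero set meets A; adding it keeps A connected, so
  maximality forces it into A. In this form, relative closedness, maximality enters the Sobolev
  argument.\<close>

lemma nodal_domain_closed_in_nonzero_set:
  assumes "open \<Omega>" "continuous_on \<Omega> u" "A \<in> nodal_domains \<Omega> u"
    and x: "x \<in> closure A" "x \<in> \<Omega>" "u x \<noteq> 0"
  shows "x \<in> A"
proof -
  have A: "open A" "connected A" "A \<subseteq> {x\<in>\<Omega>. u x \<noteq> 0}"
    "\<And>B. open B \<Longrightarrow> connected B \<Longrightarrow> B \<subseteq> {x\<in>\<Omega>. u x \<noteq> 0} \<Longrightarrow> A \<subseteq> B \<Longrightarrow> B = A"
    using assms(3) by (auto simp: nodal_domains_def)
  have "open {x\<in>\<Omega>. u x \<noteq> 0}"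
    using continuous_open_preimage[OF assms(2,1), of "- {0}"] by (simp add: vimage_def Int_def open_Compl)
  then obtain r where r: "r > 0" "ball x r \<subseteq> {x\<in>\<Omega>. u x \<noteq> 0}"
    using x by (auto simp: open_contains_ball)
  obtain y where "y \<in> A" "dist y x < r"
    using x(1) r(1) unfolding closure_approachable by blast
  then have "y \<in> A \<inter> ball x r" by (simp add: dist_commute)
  then have "A \<inter> ball x r \<noteq> {}" by blast
  then have "connected (A \<union> ball x r)"
    by (intro connected_Un A) auto
  then have "A \<union> ball x r = A" using A r by (intro A(4)) auto
  then show ?thesis using r(1) by force
qed

lemma nodal_domains_disjoint:
  assumes A: "A \<in> nodal_domains \<Omega> u" and B: "B \<in> nodal_domains \<Omega> u" and AB: "A \<inter> B \<noteq> {}"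
  shows "A = B"
proof -
  have "open (A \<union> B)" "connected (A \<union> B)" "A \<union> B \<subseteq> {x\<in>\<Omega>. u x \<noteq> 0}"
    using A B AB by (auto simp: nodal_domains_def intro!: connected_Un)
  then have "A \<union> B = A" "A \<union> B = B" using A B unfolding nodal_domains_def by blast+
  then show ?thesis by simp
qed

lemma nodal_domain_sign:
  fixes u :: "'a::euclidean_space \<Rightarrow> real"
  assumes "continuous_on \<Omega> u" "A \<in> nodal_domains \<Omega> u"
  shows "(\<forall>x\<in>A. u x > 0) \<or> (\<forall>x\<in>A. u x < 0)"
proof (rule ccontr)
  assume neg: "\<not> ?thesis"
  have A: "connected A" "A \<subseteq> {x\<in>\<Omega>. u x \<noteq> 0}" using assms(2) by (auto simp: nodal_domains_def)
  then obtain x y where xy: "x \<in> A" "y \<in> A" "u x \<le> 0" "u y \<ge> 0" using neg by (auto simp: not_less)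
  have "connected (u ` A)"
    using A by (intro connected_continuous_image continuous_on_subset[OF assms(1)]) auto
  then have "{u x..u y} \<subseteq> u ` A" using xy by (intro connected_contains_Icc) auto
  then have "0 \<in> u ` A" using xy by auto
  then show False using A(2) by auto
qed

section \<open>Restricting an eigenfunction to one nodal domain\<close>

context p_eigenfunction
begin

text \<open>The approximating functions are products of three factors: \<open>flat 0 (v k x / e)\<close>, with
  test functions \<open>v k\<close> tending to \<open>u\<close>, has compact support; \<open>soft_trunc e e (u x)\<close> vanishes near
  the relative boundary of \<open>A\<close>; and a cutoff, locally constant wherever the other two factors do
  not vanish, selects \<open>A\<close>. The cutoff depends on \<open>k\<close>, but the product does not change when
  it is replaced by the indicator of \<open>A\<close>, so that \<open>k\<close> can tend to infinity.\<close>

lemma sobolev_0_component: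
  assumes A: "open A" "A \<subseteq> \<Omega>" "\<And>x. x \<in> closure A \<Longrightarrow> x \<in> \<Omega> \<Longrightarrow> u x > 0 \<Longrightarrow> x \<in> A"
    and e: "e > 0"
  shows "sobolev_0 (\<lambda>x. indicator A x * soft_trunc e e (u x) * flat 0 (u x / e))
    (\<lambda>x. (indicator A x * ((flat 0 ((u x - e) / e) + flat 1 ((u x - e) / e)) * flat 0 (u x / e)
        + soft_trunc e e (u x) * (flat 2 (u x / e) / e))) *\<^sub>R G x)"
proof -
  define \<theta> \<theta>' \<phi> \<phi>' where defs: "\<theta> = soft_trunc e e"
    "\<theta>' = (\<lambda>t. flat 0 ((t - e) / e) + flat 1 ((t - e) / e))"
    "\<phi> = (\<lambda>t. flat 0 (t / e))" "\<phi>' = (\<lambda>t. flat 2 (t / e) / e)"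
  define I where "I = (indicator A :: 'a \<Rightarrow> real)"
  obtain M where M: "M > 0" "\<And>x. x \<in> \<Omega> \<Longrightarrow> \<bar>u x\<bar> \<le> M" using bounded_eigenfunction by blast
  have \<theta>: "C_k k \<theta>" "(\<theta> has_real_derivative \<theta>' t) (at t)" "\<bar>\<theta>' t\<bar> \<le> 2" "\<theta> 0 = 0" for k t
    using C_k_soft_trunc has_real_derivative_soft_trunc[OF e] soft_trunc_derivative_bounds soft_trunc_eq_0[OF e] e
    by (auto simp: defs)
  have \<theta>0: "\<theta> t = 0" "\<theta>' t = 0" if "t \<le> e" for t
    using that e by (auto simp: defs soft_trunc_eq_0 flat_nonpos divide_nonpos_pos)
  have \<phi>_smooth: "C_k k \<phi>" for k
    unfolding defs divide_inverse
    by (rule C_k_compose[OF C_k_flat]) (auto intro!: C_k_mult C_k_const C_k_inner_left[where c = "1::real", simplified])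
  have \<phi>_deriv: "(\<phi> has_real_derivative \<phi>' t) (at t)" for t
  proof -
    have "((\<lambda>t. t / e) has_real_derivative 1 / e) (at t)"
      using e by (auto intro!: derivative_eq_intros)
    from DERIV_chain2[OF has_real_derivative_flat[of 0] this]
    show ?thesis by (simp add: defs numeral_2_eq_2)
  qed
  have \<phi>_bd: "\<bar>\<phi>' t\<bar> \<le> 2 / e" "\<bar>\<phi> t\<bar> \<le> 1" for t
    using flat_nonneg[of 2 "t / e"] flat_le[of 2 "t / e"] flat_nonneg[of 0 "t / e"] flat_le[of 0 "t / e"] e
    by (auto simp: defs divide_right_mono)
  have \<phi>0: "\<phi> 0 = 0" "\<phi>' 0 = 0" by (auto simp: defs flat_nonpos)
  have I: "\<bar>I x\<bar> \<le> 1" for x by (simp add: I_def indicator_def)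
  have I_meas: "I \<in> borel_measurable (lebesgue_on \<Omega>)"
    unfolding I_def using A(1) by (intro borel_measurable_lebesgue_on) (simp add: borel_open)
  have \<theta>u: "sobolev_0 (\<lambda>x. \<theta> (u x)) (\<lambda>x. \<theta>' (u x) *\<^sub>R G x)"
    by (rule sobolev_0_chain[OF \<theta> sobolev])
  obtain v where v: "\<And>k. v k \<in> test_functions \<Omega>"
    "AE x in lebesgue_on \<Omega>. (\<lambda>k. v k x) \<longlonglongrightarrow> u x"
    "(\<lambda>k. Lint (\<lambda>x. v k x - u x)) \<longlonglongrightarrow> 0" "(\<lambda>k. Lint (\<lambda>x. grad (v k) x - G x)) \<longlonglongrightarrow> 0"
    by (rule sobolev_0_sequence[OF sobolev]) (rule that)
  note vC = test_functions_C_k[OF v(1)]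
  have approx: "sobolev_0 (\<lambda>x. \<phi> (v k x) * (I x * \<theta> (u x)))
      (\<lambda>x. \<phi> (v k x) *\<^sub>R ((I x * \<theta>' (u x)) *\<^sub>R G x) + (I x * \<theta> (u x)) *\<^sub>R (\<phi>' (v k x) *\<^sub>R grad (v k) x))" for k
  proof -
    define K where "K = closure {x. v k x \<noteq> 0}"
    have K: "compact K" "K \<subseteq> \<Omega>" "\<And>x. x \<notin> K \<Longrightarrow> v k x = 0"
      using v(1)[of k] closure_subset[of "{x. v k x \<noteq> 0}"] by (auto simp: K_def test_functions_def)
    define C where "C = A \<inter> {x\<in>K. e \<le> u x}"
    \<comment> \<open>Points of K lie in \<Omega>, and there u \<ge> e > 0, so passing to the
      closure of A adds no point. Hence C is closed and, within K, compact.\<close>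
    have "C = closure A \<inter> {x\<in>K. e \<le> u x}"
      using A(3) K(2) e closure_subset[of A] by (force simp: C_def)
    moreover have "closed {x\<in>K. e \<le> u x}"
      using continuous_closed_preimage[OF continuous_on_subset[OF continuous K(2)] compact_imp_closed[OF K(1)], of "{e..}"]
      by (simp add: vimage_def Int_def)
    ultimately have "closed C" by (simp add: closed_Int)
    then have "compact (K \<inter> C)" by (rule compact_Int_closed[OF K(1)])
    moreover have "K \<inter> C = C" by (auto simp: C_def)
    ultimately have "compact C" by simp
    then obtain \<zeta> where \<zeta>: "\<And>k. C_k k \<zeta>" "\<And>x. 0 \<le> \<zeta> x" "\<And>x. \<zeta> x \<le> 1"
        "\<And>x. x \<in> C \<Longrightarrow> \<zeta> x = 1" "\<And>x. x \<notin> A \<Longrightarrow> \<zeta> x = 0"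
      by (rule smooth_cutoff[OF _ A(1)]) (auto simp: C_def intro: that)
    have grad_\<zeta>: "grad \<zeta> x = 0" if "\<zeta> x = 0 \<or> \<zeta> x = 1" for x
      using that \<zeta>(2,3) by (intro grad_eq_0_at_extremum \<zeta>) auto
    have \<phi>v: "C_k j (\<lambda>x. \<phi> (v k x))" for j by (rule C_k_compose[OF \<phi>_smooth vC])
    define b where "b x = \<zeta> x * \<phi> (v k x)" for x
    have b: "C_k j b" for j unfolding b_def[abs_def] by (rule C_k_mult[OF \<zeta>(1) \<phi>v])
    have grad_b: "grad b x = (\<zeta> x * \<phi>' (v k x)) *\<^sub>R grad (v k) x + \<phi> (v k x) *\<^sub>R grad \<zeta> x" for x
      unfolding b_def[abs_def] grad_mult[OF \<zeta>(1) \<phi>v] grad_compose[OF vC \<phi>_deriv] by simp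
    have "{x. b x \<noteq> 0} \<subseteq> {x. v k x \<noteq> 0}" by (auto simp: b_def \<phi>0)
    then have supp: "closure {x. b x \<noteq> 0} \<subseteq> K" unfolding K_def by (rule closure_mono)
    obtain L1 where L1: "\<And>x. norm (b x) \<le> L1"
      by (rule bounded_if_compact_support[OF C_k_imp_continuous[OF b] K(1)]) (auto simp: b_def K(3) \<phi>0)
    obtain L2 where L2: "\<And>x. norm (grad b x) \<le> L2"
      by (rule bounded_if_compact_support[OF continuous_on_grad[OF b] K(1)])
        (use supp in \<open>auto intro!: grad_eq_0_outside_support\<close>)
    have "sobolev_0 (\<lambda>x. b x * \<theta> (u x)) (\<lambda>x. b x *\<^sub>R (\<theta>' (u x) *\<^sub>R G x) + \<theta> (u x) *\<^sub>R grad b x)"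
      by (rule sobolev_0_multiplier[OF b _ _ \<theta>u, of "max L1 L2"])
        (use L1 L2 in \<open>auto simp: le_max_iff_disj\<close>)
    \<comment> \<open>If u > e and v k is nonzero at x, then x lies in K: inside A it belongs to C,
      where \<zeta> = 1, and outside A both \<zeta> and I are 0. Either way \<zeta> takes an extreme
      value, so its gradient is 0.\<close>
    moreover have cases: "\<theta> (u x) = 0 \<and> \<theta>' (u x) = 0 \<or> v k x = 0 \<or> \<zeta> x = I x \<and> grad \<zeta> x = 0" if "x \<in> \<Omega>" for x
    proof (cases "u x \<le> e \<or> v k x = 0")
      case False
      then have "\<zeta> x = I x" using K(3)[of x] \<zeta>(4,5)[of x] by (auto simp: C_def I_def indicator_def)
      moreover from this have "grad \<zeta> x = 0" by (intro grad_\<zeta>) (auto simp: I_def indicator_def)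
      ultimately show ?thesis by simp
    qed (auto simp: \<theta>0)
    have "b x * \<theta> (u x) = \<phi> (v k x) * (I x * \<theta> (u x)) \<and>
       b x *\<^sub>R (\<theta>' (u x) *\<^sub>R G x) + \<theta> (u x) *\<^sub>R grad b x =
       \<phi> (v k x) *\<^sub>R ((I x * \<theta>' (u x)) *\<^sub>R G x) + (I x * \<theta> (u x)) *\<^sub>R (\<phi>' (v k x) *\<^sub>R grad (v k) x)"
      if "x \<in> \<Omega>" for x
      using cases[OF that] by (elim disjE conjE) (simp_all add: b_def grad_b \<phi>0 mult_ac)
    ultimately show ?thesis
      by (subst (asm) sobolev_0_cong) auto
  qed
  \<comment> \<open>Boundedness of u is needed here: this function multiplies gradients that
    converge only in L^p.\<close>
  have \<theta>_bd: "\<bar>I x * \<theta> (u x)\<bar> \<le> M" if "x \<in> \<Omega>" for x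
    using soft_trunc_bounds[OF e, of e "u x"] M(1) M(2)[OF that] e by (auto simp: I_def indicator_def defs)
  have I\<theta>: "Lp_on p \<Omega> (\<lambda>x. I x * \<theta> (u x))" "Lp_on p \<Omega> (\<lambda>x. (I x * \<theta>' (u x)) *\<^sub>R G x)"
    using Lp_on_mult_bounded[OF I_meas I sobolev_0_Lp(1)[OF \<theta>u]] Lp_on_mult_bounded[OF I_meas I sobolev_0_Lp(2)[OF \<theta>u]]
    by simp_all
  note I\<theta>_meas = Lp_on_measurable[OF I\<theta>(1)]
  have "\<phi> \<in> borel_measurable borel" "\<phi>' \<in> borel_measurable borel"
    by (intro borel_measurable_continuous_onI C_k_imp_continuous[OF \<phi>_smooth]
        C_k_real_derivative_continuous[OF \<phi>_smooth \<phi>_deriv])+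
  then have m: "(\<lambda>x. \<phi> (u x)) \<in> borel_measurable (lebesgue_on \<Omega>)" "(\<lambda>x. \<phi>' (u x)) \<in> borel_measurable (lebesgue_on \<Omega>)"
    "(\<lambda>x. \<phi> (v k x) - \<phi> (u x)) \<in> borel_measurable (lebesgue_on \<Omega>)"
    "(\<lambda>x. \<phi>' (v k x)) \<in> borel_measurable (lebesgue_on \<Omega>)" for k
    using Lp_on_measurable[OF u_Lp] Lp_on_measurable[OF test_function_Lp(1)[OF v(1)]]
    by (auto intro!: borel_measurable_diff intro: measurable_compose)
  have \<phi>'G: "Lp_on p \<Omega> (\<lambda>x. \<phi>' (u x) *\<^sub>R G x)" "Lp_on p \<Omega> (\<lambda>x. \<phi>' (v k x) *\<^sub>R grad (v k) x)" for k
    by (rule Lp_on_mult_bounded[OF m(2) \<phi>_bd(1) G_Lp] Lp_on_mult_bounded[OF m(4) \<phi>_bd(1) test_function_Lp(2)[OF v(1)]])+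
  have lim: "AE x in lebesgue_on \<Omega>. (\<lambda>k. \<phi> (v k x) - \<phi> (u x)) \<longlonglongrightarrow> 0"
    using v(2)
  proof eventually_elim
    case (elim x)
    then have "(\<lambda>k. \<phi> (v k x)) \<longlonglongrightarrow> \<phi> (u x)"
      by (rule continuous_on_tendsto_compose[OF C_k_imp_continuous[OF \<phi>_smooth, of UNIV]]) auto
    then show ?case by (simp add: LIM_zero)
  qed
  have bd2: "\<bar>\<phi> (v k x) - \<phi> (u x)\<bar> \<le> 2" for k x
    using \<phi>_bd(2)[of "v k x"] \<phi>_bd(2)[of "u x"] by linarith
  note conv = Lint_mult_tendsto_0[OF m(3) bd2 lim]
  have "sobolev_0 (\<lambda>x. \<phi> (u x) * (I x * \<theta> (u x)))
     (\<lambda>x. \<phi> (u x) *\<^sub>R ((I x * \<theta>' (u x)) *\<^sub>R G x) + (I x * \<theta> (u x)) *\<^sub>R (\<phi>' (u x) *\<^sub>R G x))"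
  proof (rule sobolev_0_limit[OF approx])
    show "Lp_on p \<Omega> (\<lambda>x. \<phi> (u x) * (I x * \<theta> (u x)))"
      using Lp_on_mult_bounded[OF m(1) \<phi>_bd(2) I\<theta>(1)] by simp
    show "Lp_on p \<Omega> (\<lambda>x. \<phi> (u x) *\<^sub>R ((I x * \<theta>' (u x)) *\<^sub>R G x) + (I x * \<theta> (u x)) *\<^sub>R (\<phi>' (u x) *\<^sub>R G x))"
      by (intro Lp_on_add Lp_on_mult_bounded[OF m(1) \<phi>_bd(2) I\<theta>(2)] Lp_on_mult_bounded[OF I\<theta>_meas \<theta>_bd \<phi>'G(1)])
    show "(\<lambda>k. Lint (\<lambda>x. \<phi> (v k x) * (I x * \<theta> (u x)) - \<phi> (u x) * (I x * \<theta> (u x)))) \<longlonglongrightarrow> 0"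
      using conv[OF I\<theta>(1)] by (simp add: left_diff_distrib)
    show "(\<lambda>k. Lint (\<lambda>x. \<phi> (v k x) *\<^sub>R ((I x * \<theta>' (u x)) *\<^sub>R G x) + (I x * \<theta> (u x)) *\<^sub>R (\<phi>' (v k x) *\<^sub>R grad (v k) x)
      - (\<phi> (u x) *\<^sub>R ((I x * \<theta>' (u x)) *\<^sub>R G x) + (I x * \<theta> (u x)) *\<^sub>R (\<phi>' (u x) *\<^sub>R G x)))) \<longlonglongrightarrow> 0"
    proof (rule Lint_tendsto_0I)
      fix k
      \<comment> \<open>\<open>?X\<close> is a fixed L^p function times bounded factors tending to 0
        almost everywhere; \<open>?Y\<close> is the gradient error in the chain rule for
        \<phi>.\<close>
      let ?X = "\<lambda>x. (\<phi> (v k x) - \<phi> (u x)) *\<^sub>R ((I x * \<theta>' (u x)) *\<^sub>R G x)"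
      let ?Y = "\<lambda>x. \<phi>' (v k x) *\<^sub>R grad (v k) x - \<phi>' (u x) *\<^sub>R G x"
      have Y: "Lp_on p \<Omega> ?Y" by (intro Lp_on_diff \<phi>'G)
      have "Lint (\<lambda>x. \<phi> (v k x) *\<^sub>R ((I x * \<theta>' (u x)) *\<^sub>R G x) + (I x * \<theta> (u x)) *\<^sub>R (\<phi>' (v k x) *\<^sub>R grad (v k) x)
        - (\<phi> (u x) *\<^sub>R ((I x * \<theta>' (u x)) *\<^sub>R G x) + (I x * \<theta> (u x)) *\<^sub>R (\<phi>' (u x) *\<^sub>R G x)))
        = Lint (\<lambda>x. ?X x + (I x * \<theta> (u x)) *\<^sub>R ?Y x)"
        by (intro Lint_cong) (simp only: scaleR_diff_left scaleR_diff_right add_diff_add)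
      also have "\<dots> \<le> 2 powr p * (Lint ?X + Lint (\<lambda>x. (I x * \<theta> (u x)) *\<^sub>R ?Y x))"
        by (intro Lint_add_le Lp_on_mult_bounded[OF m(3) bd2 I\<theta>(2)] Lp_on_mult_bounded[OF I\<theta>_meas \<theta>_bd Y])
      also have "\<dots> \<le> 2 powr p * (Lint ?X + M powr p * Lint ?Y)"
        using M(1) by (intro mult_left_mono add_left_mono Lint_mult_bounded_le \<theta>_bd Y) auto
      finally show "Lint (\<lambda>x. \<phi> (v k x) *\<^sub>R ((I x * \<theta>' (u x)) *\<^sub>R G x) + (I x * \<theta> (u x)) *\<^sub>R (\<phi>' (v k x) *\<^sub>R grad (v k) x)
        - (\<phi> (u x) *\<^sub>R ((I x * \<theta>' (u x)) *\<^sub>R G x) + (I x * \<theta> (u x)) *\<^sub>R (\<phi>' (u x) *\<^sub>R G x)))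
        \<le> 2 powr p * (Lint ?X + M powr p * Lint ?Y)" .
    next
      show "(\<lambda>k. 2 powr p * (Lint (\<lambda>x. (\<phi> (v k x) - \<phi> (u x)) *\<^sub>R ((I x * \<theta>' (u x)) *\<^sub>R G x))
         + M powr p * Lint (\<lambda>x. \<phi>' (v k x) *\<^sub>R grad (v k) x - \<phi>' (u x) *\<^sub>R G x))) \<longlonglongrightarrow> 0"
        by (rule tendsto_eq_intros conv[OF I\<theta>(2)] chain_tendsto(2)[OF \<phi>_smooth \<phi>_deriv \<phi>_bd(1) u_Lp G_Lp v] refl)+ simp
    qed
  qed
  then show ?thesis
    by (simp add: defs I_def algebra_simps)
qed

text \<open>The cut-off u satisfies the energy estimate with a multiple of its own norm on the
  right, since pairing it with u returns that norm. Dividing by it leaves a condition on the measure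
  of A alone, with a constant common to all A.\<close>

lemma component_measure_lower_bound:
  obtains c where "c > 0"
    "\<And>A. open A \<Longrightarrow> A \<noteq> {} \<Longrightarrow> A \<subseteq> \<Omega> \<Longrightarrow> (\<And>x. x \<in> A \<Longrightarrow> u x > 0) \<Longrightarrow>
      (\<And>x. x \<in> closure A \<Longrightarrow> x \<in> \<Omega> \<Longrightarrow> u x > 0 \<Longrightarrow> x \<in> A) \<Longrightarrow> c \<le> measure lborel A"
proof -
  obtain K where K: "K > 0"
    "\<And>w w' h S L. (\<And>j::nat. sobolev_0 (w j) (\<lambda>x. h j x *\<^sub>R G x)) \<Longrightarrow>
       (\<And>j x. x \<in> \<Omega> \<Longrightarrow> 0 \<le> h j x \<and> h j x \<le> L) \<Longrightarrow> S \<in> sets borel \<Longrightarrow> S \<subseteq> \<Omega> \<Longrightarrow>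
       (\<And>j x. x \<in> \<Omega> \<Longrightarrow> x \<notin> S \<Longrightarrow> w j x = 0) \<Longrightarrow> (\<And>j x. x \<in> \<Omega> \<Longrightarrow> \<bar>w j x\<bar> \<le> \<bar>u x\<bar>) \<Longrightarrow>
       w' \<in> borel_measurable (lebesgue_on \<Omega>) \<Longrightarrow> (\<And>x. x \<in> \<Omega> \<Longrightarrow> (\<lambda>j. w j x) \<longlonglongrightarrow> w' x) \<Longrightarrow>
       Lint w' \<le> K * measure lborel S powr (p / DIM('a)) * (L powr (p - 1) * (lam * pairing u w'))"
    by (fact energy_estimate)
  define n where "n = real DIM('a)"
  define Q where "Q = K * 3 powr (p - 1) * lam"
  have Q: "Q > 0" using K(1) lam_pos by (simp add: Q_def)
  show thesis
  \<comment> \<open>The measure at which \<open>Q * m powr (p / n)\<close> reaches 1.\<close>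
  proof (rule that[of "(1 / Q) powr (n / p)"])
    fix A assume A: "open A" "A \<noteq> {}" "A \<subseteq> \<Omega>" "\<And>x. x \<in> A \<Longrightarrow> u x > 0"
      "\<And>x. x \<in> closure A \<Longrightarrow> x \<in> \<Omega> \<Longrightarrow> u x > 0 \<Longrightarrow> x \<in> A"
    let ?m = "measure lborel A"
    define w where "w x = indicator A x * u x" for x
    define e where "e j = inverse (real (Suc j))" for j
    have e: "e j > 0" for j by (simp add: e_def)
    have e0: "e \<longlonglongrightarrow> 0" unfolding e_def[abs_def] by (rule LIMSEQ_inverse_real_of_nat)
    define h where "h j x = indicator A x * ((flat 0 ((u x - e j) / e j) + flat 1 ((u x - e j) / e j)) * flat 0 (u x / e j)
        + soft_trunc (e j) (e j) (u x) * (flat 2 (u x / e j) / e j))" for j x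
    define wj where "wj j x = indicator A x * soft_trunc (e j) (e j) (u x) * flat 0 (u x / e j)" for j x
    have wLp: "Lp_on p \<Omega> w"
      using Lp_on_indicator[OF borel_open[OF A(1)] u_Lp] by (simp add: w_def[abs_def])
    have "Lint w \<le> K * ?m powr (p / DIM('a)) * (3 powr (p - 1) * (lam * pairing u w))"
    proof (rule K(2)[of wj h])
      show "sobolev_0 (wj j) (\<lambda>x. h j x *\<^sub>R G x)" for j
        unfolding wj_def[abs_def] h_def by (rule sobolev_0_component[OF A(1,3,5) e])
      \<comment> \<open>The slope of the truncation times a factor at most 1 contributes 2. In the
        other term the truncation is at most u, and u / e turns \<open>flat 2\<close> into
        \<open>flat 1\<close>, which is at most 1, uniformly in e.\<close>
      show "0 \<le> h j x \<and> h j x \<le> 3" for j x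
      proof (cases "x \<in> A")
        case True
        have t: "0 \<le> soft_trunc (e j) (e j) (u x)" "soft_trunc (e j) (e j) (u x) \<le> u x"
          using soft_trunc_bounds[OF e[of j], of "e j" "u x"] A(4)[OF True] e[of j] by auto
        have f0: "0 \<le> flat 0 (u x / e j)" "flat 0 (u x / e j) \<le> 1"
          using flat_nonneg flat_le[of 0] by auto
        have f2: "0 \<le> flat 2 (u x / e j) / e j"
          using flat_nonneg e[of j] by (auto intro!: divide_nonneg_pos)
        have "soft_trunc (e j) (e j) (u x) * (flat 2 (u x / e j) / e j) \<le> u x * (flat 2 (u x / e j) / e j)"
          using t(2) f2 by (rule mult_right_mono)
        also have "\<dots> = flat 1 (u x / e j)"
          using flat_Suc[of "u x / e j" 1] by (simp add: numeral_2_eq_2)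
        also have "\<dots> \<le> 1" using flat_le[of 1] by simp
        finally have "soft_trunc (e j) (e j) (u x) * (flat 2 (u x / e j) / e j) \<le> 1" .
        moreover have "(flat 0 ((u x - e j) / e j) + flat 1 ((u x - e j) / e j)) * flat 0 (u x / e j) \<le> 2 * 1"
          by (intro mult_mono soft_trunc_derivative_bounds f0) simp
        moreover have "0 \<le> (flat 0 ((u x - e j) / e j) + flat 1 ((u x - e j) / e j)) * flat 0 (u x / e j)"
          by (intro mult_nonneg_nonneg soft_trunc_derivative_bounds f0)
        moreover have "0 \<le> soft_trunc (e j) (e j) (u x) * (flat 2 (u x / e j) / e j)"
          by (intro mult_nonneg_nonneg t f2)
        ultimately show ?thesis
          unfolding h_def using True by simp
      qed (simp add: h_def)
      show "\<bar>wj j x\<bar> \<le> \<bar>u x\<bar>" for j x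
      proof -
        have "\<bar>wj j x\<bar> \<le> soft_trunc (e j) (e j) (u x) * 1"
          using soft_trunc_bounds(1)[OF e[of j], of "e j" "u x"] flat_le[of 0 "u x / e j"] flat_nonneg[of 0 "u x / e j"]
          unfolding wj_def abs_mult by (intro mult_mono) (auto simp: indicator_def)
        then show ?thesis using soft_trunc_bounds(2)[OF e[of j], of "e j" "u x"] e[of j] by auto
      qed
      show "(\<lambda>j. wj j x) \<longlonglongrightarrow> w x" for x
      proof (cases "x \<in> A")
        case True
        have l: "(\<lambda>j. u x - e j) \<longlonglongrightarrow> u x" using tendsto_diff[OF tendsto_const e0] by simp
        have "(\<lambda>j. (u x - e j) * flat 0 ((u x - e j) / e j) * flat 0 (u x / e j)) \<longlonglongrightarrow> u x * 1 * 1"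
          by (intro tendsto_mult l flat_0_tendsto_1[OF l] flat_0_tendsto_1[OF tendsto_const] A(4) True e0 e)
        then show ?thesis using True by (simp add: wj_def w_def soft_trunc_def)
      qed (simp add: wj_def w_def)
    qed (use A Lp_on_measurable[OF wLp] in \<open>auto simp: wj_def borel_open\<close>)
    \<comment> \<open>On A the functions u and w agree, and elsewhere w is 0.\<close>
    also have "pairing u w = Lint w"
      unfolding pairing_self[symmetric] pairing_def
      by (intro Bochner_Integration.integral_cong) (auto simp: w_def indicator_def)
    finally have "Lint w * 1 \<le> Lint w * (Q * ?m powr (p / n))"
      by (simp add: Q_def n_def mult_ac)
    \<comment> \<open>Otherwise u would vanish almost everywhere on A, although it is positive there
      and a nonempty open set is not null.\<close>
    moreover have "Lint w > 0"
    proof (rule ccontr)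
      assume "\<not> Lint w > 0"
      then have "Lint w = 0" using Lint_nonneg[of w] by linarith
      then have "AE x in lebesgue_on \<Omega>. norm (w x) powr p = 0"
        unfolding Lint_def using Lp_on_integrable[OF wLp] by (subst (asm) integral_nonneg_eq_0_iff_AE) auto
      then have "AE x in lebesgue. x \<in> \<Omega> \<longrightarrow> w x = 0"
        by (simp add: AE_restrict_space_iff)
      then have "AE x in lebesgue. x \<notin> A"
        by eventually_elim (use A(3,4) in \<open>force simp: w_def\<close>)
      then have "A \<in> null_sets lebesgue"
        using AE_iff_null_sets[of A lebesgue] A(1) by (simp add: borel_open)
      then show False
        using open_not_negligible[OF A(1,2)] by (simp add: negligible_iff_null_sets)
    qed
    ultimately have "1 \<le> Q * ?m powr (p / n)" by (subst (asm) mult_le_cancel_left_pos) auto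
    then have "1 / Q \<le> ?m powr (p / n)" using Q by (simp add: field_simps)
    then have "(1 / Q) powr (n / p) \<le> (?m powr (p / n)) powr (n / p)"
      using Q p by (intro powr_mono2) (auto simp: n_def)
    then show "(1 / Q) powr (n / p) \<le> ?m" using p by (simp add: powr_powr n_def)
  qed (use Q in simp)
qed

text \<open>Disjoint sets of measure at least c cannot exceed the measure of \<Omega> in total. Each
  nodal domain has one sign, so c is the smaller of the constants for u and for -u.\<close>

lemma finite_nodal_domains: "finite (nodal_domains \<Omega> u)"
proof -
  interpret neg: p_eigenfunction \<Omega> p lam "\<lambda>x. - u x" "\<lambda>x. - G x" by (rule p_eigenfunction_uminus)
  obtain c1 where c1: "c1 > 0"
    "\<And>A. open A \<Longrightarrow> A \<noteq> {} \<Longrightarrow> A \<subseteq> \<Omega> \<Longrightarrow> (\<And>x. x \<in> A \<Longrightarrow> u x > 0) \<Longrightarrow>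
      (\<And>x. x \<in> closure A \<Longrightarrow> x \<in> \<Omega> \<Longrightarrow> u x > 0 \<Longrightarrow> x \<in> A) \<Longrightarrow> c1 \<le> measure lborel A"
    by (fact component_measure_lower_bound)
  obtain c2 where c2: "c2 > 0"
    "\<And>A. open A \<Longrightarrow> A \<noteq> {} \<Longrightarrow> A \<subseteq> \<Omega> \<Longrightarrow> (\<And>x. x \<in> A \<Longrightarrow> - u x > 0) \<Longrightarrow>
      (\<And>x. x \<in> closure A \<Longrightarrow> x \<in> \<Omega> \<Longrightarrow> - u x > 0 \<Longrightarrow> x \<in> A) \<Longrightarrow> c2 \<le> measure lborel A"
    by (fact neg.component_measure_lower_bound)
  define c where "c = min c1 c2"
  have c: "c > 0" using c1(1) c2(1) by (simp add: c_def)
  have lower: "c \<le> measure lborel A" if A: "A \<in> nodal_domains \<Omega> u" for A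
  proof -
    have A': "open A" "A \<noteq> {}" "A \<subseteq> \<Omega>" using A by (auto simp: nodal_domains_def)
    note closed = nodal_domain_closed_in_nonzero_set[OF open_domain continuous A]
    from nodal_domain_sign[OF continuous A] show ?thesis
    proof
      assume "\<forall>x\<in>A. u x > 0"
      then have "c1 \<le> measure lborel A" using closed by (intro c1 A') auto
      then show ?thesis by (simp add: c_def)
    next
      assume "\<forall>x\<in>A. u x < 0"
      then have "c2 \<le> measure lborel A" using closed by (intro c2 A') auto
      then show ?thesis by (simp add: c_def)
    qed
  qed
  \<comment> \<open>Bounding finite subfamilies uniformly yields finiteness of the whole family,
    since \<open>card\<close> of an infinite set would be 0.\<close>
  have "card F \<le> nat \<lfloor>measure lborel \<Omega> / c\<rfloor>" if F: "F \<subseteq> nodal_domains \<Omega> u" "finite F" for F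
  proof -
    have F': "A \<in> sets lborel" "A \<subseteq> \<Omega>" if "A \<in> F" for A
      using that F(1) by (auto simp: nodal_domains_def borel_open)
    have "ennreal (card F * c) = (\<Sum>A\<in>F. ennreal c)" using c by (simp add: ennreal_mult ennreal_of_nat_eq_real_of_nat)
    also have "\<dots> \<le> (\<Sum>A\<in>F. emeasure lborel A)"
      using F(1) F'(2) lower by (intro sum_mono) (auto simp: emeasure_subset_finite intro!: ennreal_leI)
    also have "\<dots> = emeasure lborel (\<Union>A\<in>F. A)"
    proof (rule sum_emeasure)
      show "disjoint_family_on (\<lambda>A. A) F"
        unfolding disjoint_family_on_def using F(1) nodal_domains_disjoint[of _ \<Omega> u] by blast
    qed (use F F' in auto)
    also have "\<dots> \<le> emeasure lborel \<Omega>"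
      using F' open_domain by (intro emeasure_mono) (auto simp: borel_open)
    also have "\<dots> = ennreal (measure lborel \<Omega>)" by (simp add: emeasure_subset_finite)
    finally have "card F * c \<le> measure lborel \<Omega>" by (simp add: ennreal_le_iff)
    then have "real (card F) \<le> measure lborel \<Omega> / c" using c by (simp add: field_simps)
    then show ?thesis by (simp add: le_nat_floor)
  qed
  then show ?thesis using finite_if_finite_subsets_card_bdd by blast
qed

end

section \<open>From the eigenvalue problem to the count of nodal domains\<close>

lemma dirichlet_p_eigenfunction_imp_locale:
  assumes "1 < p" "open \<Omega>" "bounded \<Omega>" "dirichlet_p_eigenfunction p \<Omega> lam u" "continuous_on \<Omega> u"
  obtains G where "p_eigenfunction \<Omega> p lam u G"
proof -
  interpret bounded_domain \<Omega> p using assms by unfold_locales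
  obtain G where nz: "\<not> (AE x in lebesgue_on \<Omega>. u x = 0)" and G: "W1p_0 p \<Omega> u G"
    and weak: "\<And>v. v \<in> test_functions \<Omega> \<Longrightarrow>
          integral\<^sup>L (lebesgue_on \<Omega>) (\<lambda>x. (norm (G x) powr (p - 2) *\<^sub>R G x) \<bullet> grad v x)
          - lam * integral\<^sup>L (lebesgue_on \<Omega>) (\<lambda>x. \<bar>u x\<bar> powr (p - 2) * u x * v x) = 0"
    using assms(4) unfolding dirichlet_p_eigenfunction_def by blast
  obtain v where v: "\<And>k. v k \<in> test_functions \<Omega>"
    "(\<lambda>k. Lint (\<lambda>x. u x - v k x)) \<longlonglongrightarrow> 0" "(\<lambda>k. Lint (\<lambda>x. G x - grad (v k) x)) \<longlonglongrightarrow> 0"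
    using G by (auto simp: W1p_0_def Lint_def)
  have "Lp_on p \<Omega> u" "Lp_on p \<Omega> G" using G by (auto simp: W1p_0_def W1p_def)
  then have "sobolev_0 u G"
    by (rule sobolev_0_limit[OF sobolev_0_test[OF v(1)]])
      (use v(2,3) in \<open>simp_all add: Lint_diff_commute[of u] Lint_diff_commute[of G]\<close>)
  moreover have "pairing G (grad v) = lam * pairing u v" if "v \<in> test_functions \<Omega>" for v
    using weak[OF that] by (simp add: pairing_def mult.assoc)
  ultimately have "p_eigenfunction \<Omega> p lam u G"
    using nz assms(5) by unfold_locales auto
  then show thesis by (rule that)
qed

theorem corollary1p7p6:
  fixes p lam :: real and \<Omega> :: "(real ^ 'n) set" and u :: "real ^ 'n \<Rightarrow> real"
  assumes "1 < p"
    and "open \<Omega>" and "connected \<Omega>" and "bounded \<Omega>"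
    and "dirichlet_p_eigenfunction p \<Omega> lam u"
    and "continuous_on \<Omega> u"
  shows "\<exists>C>0. \<forall>a>0.
    finite {A \<in> nodal_domains \<Omega> u. ereal a \<le> nodal_max u A} \<and>
    real (card {A \<in> nodal_domains \<Omega> u. ereal a \<le> nodal_max u A})
      \<le> C * inverse a * lam powr (real CARD('n) / p)"
proof -
  obtain G where "p_eigenfunction \<Omega> p lam u G"
    by (rule dirichlet_p_eigenfunction_imp_locale[OF assms(1,2,4-6)])
  then interpret p_eigenfunction \<Omega> p lam u G .
  obtain M where M: "M > 0" "\<And>x. x \<in> \<Omega> \<Longrightarrow> \<bar>u x\<bar> \<le> M" using bounded_eigenfunction by blast
  define N where "N = card (nodal_domains \<Omega> u)"
  define q where "q = lam powr (real CARD('n) / p)"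
  have q: "q > 0" using lam_pos by (simp add: q_def)
  \<comment> \<open>The count is at most N and is 0 for a > M, so the count times a never exceeds N
    M. Dividing by q compensates the power of \<open>lam\<close> in the claim, and the summand 1
    makes C positive without an argument that N is positive.\<close>
  define C where "C = (N * M + 1) / q"
  have C: "C > 0" using M(1) q by (simp add: C_def add_nonneg_pos)
  show ?thesis
  proof (rule exI[of _ C], intro conjI allI impI C)
    fix a :: real assume a: "a > 0"
    let ?S = "{A \<in> nodal_domains \<Omega> u. ereal a \<le> nodal_max u A}"
    show "finite ?S" using finite_nodal_domains by simp
    have card: "real (card ?S) \<le> N"
      unfolding N_def using finite_nodal_domains by (intro of_nat_mono card_mono) auto
    \<comment> \<open>The supremum over A is at most M, so for a > M no domain is counted.\<close>
    have le: "a \<le> M" if "A \<in> ?S" for A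
    proof -
      have "A \<subseteq> \<Omega>" using that by (auto simp: nodal_domains_def)
      then have "nodal_max u A \<le> ereal M"
        unfolding nodal_max_def using M(2) by (intro SUP_least) auto
      then show ?thesis using that order_trans ereal_less_eq(3) by blast
    qed
    have "real (card ?S) * a \<le> N * M + 1"
    proof (cases "?S = {}")
      case False
      then have "a \<le> M" using le by blast
      then have "real (card ?S) * a \<le> N * M" using card a by (intro mult_mono) auto
      then show ?thesis by simp
    next
      case True
      show ?thesis unfolding True using M(1) by simp
    qed
    then have "real (card ?S) \<le> (N * M + 1) / a"
      using a by (simp add: pos_le_divide_eq)
    also have "\<dots> = C * inverse a * q" using q by (simp add: C_def divide_inverse)
    finally show "real (card ?S) \<le> C * inverse a * lam powr (real CARD('n) / p)"
      by (simp add: q_def)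
  qed
qed

end
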